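(* For $n\ge 2$, the abelianization $A_1^{n-2}(\mathcal{T}_n)^{ab}$ of the $(n-2)$-discrete fundamental group of $\mathcal{T}_n$ is a free abelian group with a minimal generating set of size $\binom{n+2}{4}$.
   Context: Let $P_{n+3}$ be a convex $(n+3)$-gon. $\mathcal{T}_n$ is the simplicial complex whose vertices are the diagonals of $P_{n+3}$ and whose simplices are sets of pairwise non-crossing diagonals; its maximal simplices are the triangulations of $P_{n+3}$ ($n$ diagonals each). Discrete fundamental group: for $q=n-2$, two maximal simplices are $q$-near if they share a $q$-face, i.e. two triangulations are $q$-near iff they are equal or differ by a single diagonal flip. A $q$-loop based at a triangulation $\sigma_0$ is a sequence $\sigma_0,\sigma_1,\dots,\sigma_k=\sigma_0$ with consecutive terms $q$-near. The equivalence $\simeq_A$ on such loops is generated by (1) repeating a term of a loop, and (2) declaring two loops of the same length equivalent if there is a grid between them: a finite sequence of loops of that length, all based at $\sigma_0$, starting at one and ending at the other, with the $i$-th terms of consecutive loops $q$-near for every $i$. The equivalence classes form a group $A_1^{n-2}(\mathcal{T}_n)$ under concatenation (independent of base point up to isomorphism). Equivalently (a known fact), it is isomorphic to $\pi_1(X_\Gamma)$, where $\Gamma$ is the flip graph (nodes: triangulations; edges: single diagonal flips) and $X_\Gamma$ is the 2-complex obtained by attaching a 2-cell along every 3- and 4-cycle of $\Gamma$; thus $A_1^{n-2}(\mathcal{T}_n)^{ab}\cong H_1(X_\Gamma;\mathbb{Z})$. *)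

theory Defs
  imports "HOL-Algebra.Generated_Groups" "HOL-Algebra.Free_Abelian_Groups"
begin

text \<open>A simplicial complex is given by its set of simplices, each simplex being a set of
  vertices. A simplex of dimension \<open>q\<close> has \<open>q + 1\<close> vertices.\<close>

definition maximal_simplices :: "'a set set \<Rightarrow> 'a set set" where
  "maximal_simplices K = {\<sigma> \<in> K. \<forall>\<tau>\<in>K. \<sigma> \<subseteq> \<tau> \<longrightarrow> \<tau> = \<sigma>}"

definition q_near :: "'a set set \<Rightarrow> nat \<Rightarrow> 'a set \<Rightarrow> 'a set \<Rightarrow> bool" where
  "q_near K q \<sigma> \<tau> \<longleftrightarrow> (\<exists>\<rho>\<in>K. card \<rho> = q + 1 \<and> \<rho> \<subseteq> \<sigma> \<and> \<rho> \<subseteq> \<tau>)"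

definition q_loops :: "'a set set \<Rightarrow> nat \<Rightarrow> 'a set \<Rightarrow> 'a set list set" where
  "q_loops K q \<sigma>\<^sub>0 =
     {xs. xs \<noteq> [] \<and> hd xs = \<sigma>\<^sub>0 \<and> last xs = \<sigma>\<^sub>0 \<and>
          set xs \<subseteq> maximal_simplices K \<and> successively (q_near K q) xs}"

text \<open>In the second rule the list \<open>gs\<close> is the grid, its entries being the rows;
  \<^const>\<open>list_all2\<close> forces all rows to have the same length.\<close>

inductive loop_equiv :: "'a set set \<Rightarrow> nat \<Rightarrow> 'a set \<Rightarrow> 'a set list \<Rightarrow> 'a set list \<Rightarrow> bool"
  for K q \<sigma>\<^sub>0 where
  repeat_term: "xs @ [x] @ ys \<in> q_loops K q \<sigma>\<^sub>0 \<Longrightarrow> xs @ [x, x] @ ys \<in> q_loops K q \<sigma>\<^sub>0 \<Longrightarrow>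
     loop_equiv K q \<sigma>\<^sub>0 (xs @ [x] @ ys) (xs @ [x, x] @ ys)"
| grid: "gs \<noteq> [] \<Longrightarrow> set gs \<subseteq> q_loops K q \<sigma>\<^sub>0 \<Longrightarrow> successively (list_all2 (q_near K q)) gs \<Longrightarrow>
     loop_equiv K q \<sigma>\<^sub>0 (hd gs) (last gs)"
| refl: "a \<in> q_loops K q \<sigma>\<^sub>0 \<Longrightarrow> loop_equiv K q \<sigma>\<^sub>0 a a"
| sym: "loop_equiv K q \<sigma>\<^sub>0 a b \<Longrightarrow> loop_equiv K q \<sigma>\<^sub>0 b a"
| trans: "loop_equiv K q \<sigma>\<^sub>0 a b \<Longrightarrow> loop_equiv K q \<sigma>\<^sub>0 b c \<Longrightarrow> loop_equiv K q \<sigma>\<^sub>0 a c"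

definition loop_rel :: "'a set set \<Rightarrow> nat \<Rightarrow> 'a set \<Rightarrow> ('a set list \<times> 'a set list) set" where
  "loop_rel K q \<sigma>\<^sub>0 = {(a, b). loop_equiv K q \<sigma>\<^sub>0 a b}"

definition discrete_fundamental_group ::
    "'a set set \<Rightarrow> nat \<Rightarrow> 'a set \<Rightarrow> 'a set list set monoid" where
  "discrete_fundamental_group K q \<sigma>\<^sub>0 =
     \<lparr>carrier = q_loops K q \<sigma>\<^sub>0 // loop_rel K q \<sigma>\<^sub>0,
      monoid.mult = (\<lambda>C D. \<Union>a\<in>C. \<Union>b\<in>D. loop_rel K q \<sigma>\<^sub>0 `` {a @ tl b}),
      one = loop_rel K q \<sigma>\<^sub>0 `` {[\<sigma>\<^sub>0]}\<rparr>"

definition abelianization :: "('a, 'b) monoid_scheme \<Rightarrow> 'a set monoid" where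
  "abelianization G = G Mod (derived G (carrier G))"

text \<open>Minimality is with respect to cardinality: an inclusion-minimal generating set of a free
  abelian group can be larger than the rank, as \<open>{2, 3}\<close> in the integers shows.\<close>

definition minimal_generating_set :: "('a, 'b) monoid_scheme \<Rightarrow> 'a set \<Rightarrow> bool" where
  "minimal_generating_set G S \<longleftrightarrow>
     finite S \<and> S \<subseteq> carrier G \<and> generate G S = carrier G \<and>
     (\<forall>T. finite T \<and> T \<subseteq> carrier G \<and> generate G T = carrier G \<longrightarrow> card S \<le> card T)"

text \<open>The vertices of a convex \<open>m\<close>-gon are numbered \<open>0, \<dots>, m - 1\<close> in cyclic order; the diagonal
  joining \<open>i < j\<close> is the pair \<open>(i, j)\<close>. By convexity two diagonals cross (in their interiors)
  iff their end points alternate along the boundary.\<close>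

definition diagonals :: "nat \<Rightarrow> (nat \<times> nat) set" where
  "diagonals m = {(i, j). i + 1 < j \<and> j < m \<and> (i, j) \<noteq> (0, m - 1)}"

fun crossing :: "nat \<times> nat \<Rightarrow> nat \<times> nat \<Rightarrow> bool" where
  "crossing (i, j) (k, l) \<longleftrightarrow> (i < k \<and> k < j \<and> j < l) \<or> (k < i \<and> i < l \<and> l < j)"

definition noncrossing_complex :: "nat \<Rightarrow> (nat \<times> nat) set set" where
  "noncrossing_complex n =
     {S. S \<subseteq> diagonals (n + 3) \<and> (\<forall>d\<in>S. \<forall>e\<in>S. \<not> crossing d e)}"

lemma q_near_sym: "q_near K q x y \<Longrightarrow> q_near K q y x"
  by (auto simp: q_near_def)

lemma q_near_refl: "q_near K q x y \<Longrightarrow> q_near K q x x"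
  by (auto simp: q_near_def)

lemma loop_equiv_loops:
  "loop_equiv K q s a b \<Longrightarrow> a \<in> q_loops K q s \<and> b \<in> q_loops K q s"
  by (induction rule: loop_equiv.induct) auto

lemma equiv_loop_rel: "equiv (q_loops K q s) (loop_rel K q s)"
proof (rule equivI)
  show "loop_rel K q s \<subseteq> q_loops K q s \<times> q_loops K q s"
    using loop_equiv_loops by (force simp: loop_rel_def)
  show "refl_on (q_loops K q s) (loop_rel K q s)"
    by (auto simp: refl_on_def loop_rel_def intro: loop_equiv.refl)
  show "sym (loop_rel K q s)"
    by (auto simp: sym_def loop_rel_def intro: loop_equiv.sym)
  show "trans (loop_rel K q s)"
    by (auto simp: trans_def loop_rel_def intro: loop_equiv.trans)
qed

lemma concat_loops:
  assumes "a \<in> q_loops K q s" "b \<in> q_loops K q s"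
  shows "a @ tl b \<in> q_loops K q s"
proof -
  obtain b' where b: "b = s # b'"
    using assms(2) by (cases b) (auto simp: q_loops_def)
  show ?thesis
    using assms unfolding b
    by (auto simp: q_loops_def successively_append_iff successively_Cons last_append split: if_splits)
qed

lemma successively_near_self:
  assumes "successively (q_near K q) (x # y # zs)" "z \<in> set (x # y # zs)"
  shows "q_near K q z z"
  using assms
proof (induction zs arbitrary: x y)
  case Nil
  then show ?case by (auto intro: q_near_refl q_near_sym)
next
  case (Cons a zs)
  then show ?case
    by (metis q_near_refl set_ConsD successively.simps(3))
qed

lemma loop_near_self:
  assumes "a \<in> q_loops K q s" "z \<in> set (tl a)"
  shows "q_near K q z z"
proof (cases a)
  case (Cons x xs)
  show ?thesis
  proof (cases xs)
    case (Cons y ys)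
    with \<open>a = x # xs\<close> assms show ?thesis
      by (intro successively_near_self[of K q x y ys]) (auto simp: q_loops_def)
  qed (use assms \<open>a = x # xs\<close> in auto)
qed (use assms in auto)

lemma list_all2_self: "(\<And>z. z \<in> set xs \<Longrightarrow> P z z) \<Longrightarrow> list_all2 P xs xs"
  by (induction xs) auto

lemma concat_cong_left:
  assumes "loop_equiv K q s a a'" "b \<in> q_loops K q s"
  shows "loop_equiv K q s (a @ tl b) (a' @ tl b)"
  using assms(1)
proof induction
  case (repeat_term xs x ys)
  show ?case
    using loop_equiv.repeat_term[of xs x "ys @ tl b" K q s]
      concat_loops[OF repeat_term(1) assms(2)] concat_loops[OF repeat_term(2) assms(2)]
    by simp
next
  case (grid gs)
  let ?f = "\<lambda>g. g @ tl b"
  have "successively (list_all2 (q_near K q)) (map ?f gs)"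
    unfolding successively_map
    by (rule successively_mono[OF grid(3)])
      (use loop_near_self[OF assms(2)] in \<open>auto intro!: list_all2_appendI list_all2_self\<close>)
  moreover have "set (map ?f gs) \<subseteq> q_loops K q s"
    using grid(2) concat_loops[OF _ assms(2)] by auto
  ultimately have "loop_equiv K q s (hd (map ?f gs)) (last (map ?f gs))"
    using grid(1) by (intro loop_equiv.grid) auto
  then show ?case
    using grid(1) by (simp add: hd_map last_map)
next
  case (refl a)
  then show ?case by (intro loop_equiv.refl concat_loops assms(2))
next
  case (sym a b)
  then show ?case by (blast intro: loop_equiv.sym)
next
  case (trans a b c)
  then show ?case by (blast intro: loop_equiv.trans)
qed

lemma concat_cong_right:
  assumes "loop_equiv K q s b b'" "a \<in> q_loops K q s"
  shows "loop_equiv K q s (a @ tl b) (a @ tl b')"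
  using assms(1)
proof induction
  case (repeat_term xs x ys)
  note L = concat_loops[OF assms(2) repeat_term(1)] concat_loops[OF assms(2) repeat_term(2)]
  show ?case
  proof (cases xs)
    case Nil
    obtain a' where a: "a = a' @ [s]"
      using assms(2) by (cases a rule: rev_cases) (auto simp: q_loops_def)
    have "x = s" using repeat_term(1) Nil by (simp add: q_loops_def)
    then show ?thesis
      using loop_equiv.repeat_term[of a' s ys K q s] L Nil a by simp
  next
    case (Cons z zs)
    then show ?thesis
      using loop_equiv.repeat_term[of "a @ zs" x ys K q s] L by simp
  qed
next
  case (grid gs)
  show ?case
  proof (cases "length a = 1")
    case True
    then have a: "a = [s]"
      using assms(2) by (cases a) (auto simp: q_loops_def)
    have "a @ tl g = g" if "g \<in> q_loops K q s" for g
      using that a by (cases g) (auto simp: q_loops_def)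
    moreover have "hd gs \<in> q_loops K q s" "last gs \<in> q_loops K q s"
      using grid by auto
    ultimately show ?thesis
      using loop_equiv.grid[OF grid] by simp
  next
    case False
    then obtain x y zs where a: "a = x # y # zs"
      using assms(2) by (cases a rule: remdups_adj.cases) (auto simp: q_loops_def)
    have self: "q_near K q z z" if "z \<in> set a" for z
      using successively_near_self[of K q x y zs z] that assms(2) a
      by (auto simp: q_loops_def)
    let ?f = "\<lambda>g. a @ tl g"
    have "successively (list_all2 (q_near K q)) (map ?f gs)"
      unfolding successively_map
    proof (rule successively_mono[OF grid(3)])
      fix g h assume "list_all2 (q_near K q) g h"
      then have "list_all2 (q_near K q) (tl g) (tl h)"
        by (cases rule: list.rel_cases) auto
      then show "list_all2 (q_near K q) (a @ tl g) (a @ tl h)"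
        using self by (intro list_all2_appendI list_all2_self)
    qed
    moreover have "set (map ?f gs) \<subseteq> q_loops K q s"
      using grid(2) concat_loops[OF assms(2)] by auto
    ultimately have "loop_equiv K q s (hd (map ?f gs)) (last (map ?f gs))"
      using grid(1) by (intro loop_equiv.grid) auto
    then show ?thesis
      using grid(1) by (simp add: hd_map last_map)
  qed
next
  case (refl b)
  then show ?case by (intro loop_equiv.refl concat_loops assms(2))
next
  case (sym a b)
  then show ?case by (blast intro: loop_equiv.sym)
next
  case (trans a b c)
  then show ?case by (blast intro: loop_equiv.trans)
qed

lemma rev_loop: "a \<in> q_loops K q s \<Longrightarrow> rev a \<in> q_loops K q s"
  by (auto simp: q_loops_def hd_rev last_rev q_near_sym elim: successively_mono)

lemma backtrack:
  assumes "xs @ [x, y, x] @ ys \<in> q_loops K q s"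
  shows "loop_equiv K q s (xs @ [x, y, x] @ ys) (xs @ [x] @ ys)"
proof -
  let ?a = "xs @ [x, y, x] @ ys"
  have xy: "q_near K q x y"
    using assms by (auto simp: q_loops_def successively_append_iff)
  have self: "q_near K q z z" if "z \<in> set ?a" for z
  proof -
    obtain u v w where a: "?a = u # v # w"
      by (cases ?a rule: remdups_adj.cases) (auto simp: append_eq_Cons_conv)
    show ?thesis
      using successively_near_self[of K q u v w z] that assms unfolding a
      by (auto simp: q_loops_def)
  qed
  have xx: "q_near K q x x"
    by (rule self) simp
  have sets: "set xs \<subseteq> maximal_simplices K" "set ys \<subseteq> maximal_simplices K"
      "x \<in> maximal_simplices K"
    and ends: "hd (xs @ [x]) = s" "last (x # ys) = s"
    and succ: "successively (q_near K q) (xs @ [x])" "successively (q_near K q) (x # ys)"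
    using assms
    by (auto simp: q_loops_def successively_append_iff hd_append split: if_splits)
  have loop: "xs @ [x] @ zs @ ys \<in> q_loops K q s" if "zs = replicate k x" for zs k
  proof -
    have "hd (xs @ [x] @ zs @ ys) = s"
      using ends(1) by (cases xs) auto
    moreover have "last (xs @ [x] @ zs @ ys) = s"
      using ends(2) that by (cases "ys = []"; cases k) auto
    moreover have "successively (q_near K q) (x # zs @ ys)"
      unfolding that using succ(2) xx by (induction k) (auto simp: successively_Cons)
    then have "successively (q_near K q) (xs @ [x] @ zs @ ys)"
      using succ(1) by (auto simp: successively_append_iff)
    ultimately show ?thesis
      using sets that by (auto simp: q_loops_def)
  qed
  have L3: "xs @ [x, x, x] @ ys \<in> q_loops K q s"
    using loop[of "[x, x]" 2] by (simp add: numeral_2_eq_2)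
  have L2: "xs @ [x, x] @ ys \<in> q_loops K q s"
    using loop[of "[x]" 1] by simp
  have L1: "xs @ [x] @ ys \<in> q_loops K q s"
    using loop[of "[]" 0] by simp
  have "list_all2 (q_near K q) ?a (xs @ [x, x, x] @ ys)"
    using self q_near_sym[OF xy] by (intro list_all2_appendI list_all2_self) auto
  then have "loop_equiv K q s ?a (xs @ [x, x, x] @ ys)"
    using loop_equiv.grid[of "[?a, xs @ [x, x, x] @ ys]" K q s] assms L3 by simp
  moreover have "loop_equiv K q s (xs @ [x, x] @ ys) (xs @ [x, x, x] @ ys)"
    using loop_equiv.repeat_term[of xs x "x # ys" K q s] L2 L3 by simp
  moreover have "loop_equiv K q s (xs @ [x] @ ys) (xs @ [x, x] @ ys)"
    using loop_equiv.repeat_term[of xs x ys K q s] L2 L1 by simp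
  ultimately show ?thesis
    by (blast intro: loop_equiv.sym loop_equiv.trans)
qed

lemma path_back:
  assumes "p @ [x] @ rev p \<in> q_loops K q s"
  shows "loop_equiv K q s (p @ [x] @ rev p) [s]"
  using assms
proof (induction p arbitrary: x rule: rev_induct)
  case Nil
  then show ?case
    using loop_equiv.refl[OF Nil] by (simp add: q_loops_def)
next
  case (snoc y p)
  have "loop_equiv K q s ((p @ [y]) @ [x] @ rev (p @ [y])) (p @ [y] @ rev p)"
    using backtrack[of p y x "rev p" K q s] snoc.prems by simp
  then show ?case
    using snoc.IH[of y] loop_equiv_loops loop_equiv.trans by meson
qed

lemma group_discrete_fundamental_group:
  assumes "\<sigma>\<^sub>0 \<in> maximal_simplices K"
  shows "group (discrete_fundamental_group K q \<sigma>\<^sub>0)"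
proof -
  let ?L = "q_loops K q \<sigma>\<^sub>0" and ?R = "loop_rel K q \<sigma>\<^sub>0"
  let ?G = "discrete_fundamental_group K q \<sigma>\<^sub>0"
  note eq = equiv_loop_rel[of K q \<sigma>\<^sub>0]
  have R: "(a, b) \<in> ?R \<longleftrightarrow> loop_equiv K q \<sigma>\<^sub>0 a b" for a b
    by (simp add: loop_rel_def)
  have "congruent2 ?R ?R (\<lambda>a b. ?R `` {a @ tl b})"
  proof (rule congruent2I[OF eq eq])
    fix a a' b assume "b \<in> ?L" "(a, a') \<in> ?R"
    then show "?R `` {a @ tl b} = ?R `` {a' @ tl b}"
      using equiv_class_eq[OF eq] concat_cong_left unfolding R by blast
  next
    fix a a' b assume "b \<in> ?L" "(a, a') \<in> ?R"
    then show "?R `` {b @ tl a} = ?R `` {b @ tl a'}"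
      using equiv_class_eq[OF eq] concat_cong_right unfolding R by blast
  qed
  then have mult: "?R `` {a} \<otimes>\<^bsub>?G\<^esub> ?R `` {b} = ?R `` {a @ tl b}" if "a \<in> ?L" "b \<in> ?L" for a b
    using UN_equiv_class2[OF eq eq _ that] by (simp add: discrete_fundamental_group_def)
  have one: "\<one>\<^bsub>?G\<^esub> = ?R `` {[\<sigma>\<^sub>0]}"
    by (simp add: discrete_fundamental_group_def)
  have carr: "carrier ?G = ?L // ?R"
    by (simp add: discrete_fundamental_group_def)
  have one_L: "[\<sigma>\<^sub>0] \<in> ?L"
    using assms by (simp add: q_loops_def)
  have ne: "a \<noteq> []" "[\<sigma>\<^sub>0] @ tl a = a" if "a \<in> ?L" for a
    using that by (cases a; auto simp: q_loops_def)+
  show ?thesis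
  proof (rule groupI)
    fix C D assume "C \<in> carrier ?G" "D \<in> carrier ?G"
    then show "C \<otimes>\<^bsub>?G\<^esub> D \<in> carrier ?G"
      unfolding carr by (elim quotientE) (auto simp: mult intro!: quotientI concat_loops)
  next
    show "\<one>\<^bsub>?G\<^esub> \<in> carrier ?G"
      unfolding carr one by (rule quotientI[OF one_L])
  next
    fix C D E assume "C \<in> carrier ?G" "D \<in> carrier ?G" "E \<in> carrier ?G"
    then show "C \<otimes>\<^bsub>?G\<^esub> D \<otimes>\<^bsub>?G\<^esub> E = C \<otimes>\<^bsub>?G\<^esub> (D \<otimes>\<^bsub>?G\<^esub> E)"
      unfolding carr by (elim quotientE) (simp add: mult concat_loops ne)
  next
    fix C assume "C \<in> carrier ?G"
    then show "\<one>\<^bsub>?G\<^esub> \<otimes>\<^bsub>?G\<^esub> C = C"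
      unfolding carr one by (elim quotientE) (simp only: mult one_L ne)
  next
    fix C assume "C \<in> carrier ?G"
    then obtain a where a: "C = ?R `` {a}" "a \<in> ?L"
      unfolding carr by (elim quotientE)
    obtain p x where px: "rev a = p @ [x]"
      using ne(1)[OF a(2)] by (metis rev_exhaust rev_is_Nil_conv)
    then have "a = x # rev p"
      by (simp add: rev_eq_append_conv)
    then have eq1: "rev a @ tl a = p @ [x] @ rev p"
      using px by simp
    have "loop_equiv K q \<sigma>\<^sub>0 (rev a @ tl a) [\<sigma>\<^sub>0]"
      using path_back[of p x K q \<sigma>\<^sub>0] concat_loops[OF rev_loop[OF a(2)] a(2)]
      unfolding eq1 by blast
    then have "?R `` {rev a} \<otimes>\<^bsub>?G\<^esub> C = \<one>\<^bsub>?G\<^esub>"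
      unfolding a(1) one mult[OF rev_loop[OF a(2)] a(2)] using equiv_class_eq[OF eq] R by blast
    then show "\<exists>D\<in>carrier ?G. D \<otimes>\<^bsub>?G\<^esub> C = \<one>\<^bsub>?G\<^esub>"
      unfolding carr using quotientI[OF rev_loop[OF a(2)]] by blast
  qed
qed

end

theory Submission
  imports Defs
begin

text \<open>
  Flipping the quadrilateral \<open>a < b < c < d\<close> from \<open>bd\<close> to \<open>ac\<close> is a down flip. Counting, with sign, the
  flips of a loop in each quadrilateral that avoids the vertex 0 is a homotopy invariant, because the
  only nondegenerate closed walks of length four are squares of commuting flips. It maps the group
  onto the free abelian group on the \<open>(n + 2) choose 4\<close> such quadrilaterals: the loop around the
  pentagon \<open>0abcd\<close> counts only \<open>abcd\<close>.

  It remains to see that a loop with zero count is a product of commutators. Down flips at vertex 0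
  form a confluent system modulo squares, so a cocycle with values in an abelian group can be
  normalised to vanish on them. The normalised value of a down flip in \<open>abcd\<close> then does not depend on
  the rest of the triangulation: it is unchanged by disjoint flips at 0 (squares), which lead to a
  triangulation containing the triangle \<open>0ad\<close>; there it is unchanged by every other disjoint
  down flip as well, since the pentagon \<open>0abcd\<close> expresses the flip in \<open>abcd\<close> by flips at 0; and disjoint
  down flips end in a unique triangulation.
\<close>

section \<open>Triangulations\<close>

text \<open>The hard half is that the kernel of the count is no larger than the commutator subgroup.
  It is proved dually: with A the abelianization itself, a flip from x to y receives the class of
  the loop that runs along chosen paths from the base point to x, over to y and back. This is a
  cocycle, and its product along a loop is the class of that loop. So it suffices that every cocycle
  with values in an abelian group is, up to a coboundary, a function of the signed counts.

  The obstacle there is that a square of disjoint flips in \<open>abcd\<close> and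
  \<open>pqrs\<close> does not say that either value is preserved, only that both change by the same
  amount. One of the two values must be known to be constant for another reason: a flip at 0 has
  value zero, and a flip across a pentagon at 0 can be rerouted through such flips. The second
  reason needs the triangle \<open>0ad\<close>, which explains why flips at 0 are done first.

  Pentagons are never filled by homotopies. Those with a corner at 0 correspond to the 4-subsets of
  the other n + 2 vertices, which is the origin of the binomial coefficient.

  That no generating set is smaller than the basis is a count of homomorphisms to Z/2.\<close>

abbreviation triangulations :: "nat \<Rightarrow> (nat \<times> nat) set set" where
  "triangulations n \<equiv> maximal_simplices (noncrossing_complex n)"

text \<open>Sides of the polygon count as edges, so triangles and quadrilaterals need no case
  distinction according to which of their sides lie on the boundary. The side from 0 to the last
  vertex n + 2 serves as the root.\<close>

definition edge :: "nat \<Rightarrow> (nat \<times> nat) set \<Rightarrow> nat \<Rightarrow> nat \<Rightarrow> bool" where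
  "edge n T i j \<longleftrightarrow> (i, j) \<in> T \<or> j = Suc i \<and> j \<le> n + 2 \<or> i = 0 \<and> j = n + 2"

lemma finite_diagonals: "finite (diagonals m)"
  by (rule finite_subset[of _ "{..<m} \<times> {..<m}"]) (auto simp: diagonals_def)

lemma noncrossing_complex_finite: "T \<in> noncrossing_complex n \<Longrightarrow> finite T"
  using finite_diagonals finite_subset by (auto simp: noncrossing_complex_def)

lemma finite_noncrossing_complex: "finite (noncrossing_complex n)"
  by (rule finite_subset[of _ "Pow (diagonals (n + 3))"])
    (auto simp: noncrossing_complex_def finite_diagonals)

lemma triangulation_extending:
  assumes "S \<in> noncrossing_complex n"
  obtains T where "T \<in> triangulations n" "S \<subseteq> T"
proof -
  have "finite {T \<in> noncrossing_complex n. S \<subseteq> T}"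
    using finite_noncrossing_complex by simp
  from finite_has_maximal[OF this] assms obtain T where
    "T \<in> noncrossing_complex n" "S \<subseteq> T"
    "\<forall>U\<in>{T \<in> noncrossing_complex n. S \<subseteq> T}. T \<subseteq> U \<longrightarrow> T = U"
    by auto
  moreover from this have "T \<in> triangulations n"
    unfolding maximal_simplices_def by blast
  ultimately show ?thesis
    using that by blast
qed

lemma noncrossing_complex_mono: "T \<in> noncrossing_complex n \<Longrightarrow> S \<subseteq> T \<Longrightarrow> S \<in> noncrossing_complex n"
  unfolding noncrossing_complex_def by blast

lemma triangulation_finite: "T \<in> triangulations n \<Longrightarrow> finite T"
  by (auto simp: maximal_simplices_def noncrossing_complex_finite)

lemma crossing_sym: "crossing d e \<longleftrightarrow> crossing e d"
  by (cases d; cases e) auto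

lemma not_crossing_self: "\<not> crossing d d"
  by (cases d) auto

lemma triangulation_subset: "T \<in> triangulations n \<Longrightarrow> T \<subseteq> diagonals (n + 3)"
  by (simp add: maximal_simplices_def noncrossing_complex_def)

lemma triangulation_noncrossing:
  "T \<in> triangulations n \<Longrightarrow> d \<in> T \<Longrightarrow> e \<in> T \<Longrightarrow> \<not> crossing d e"
  by (simp add: maximal_simplices_def noncrossing_complex_def)

lemma in_triangulation:
  assumes "T \<in> triangulations n" "(i, j) \<in> T"
  shows "i + 1 < j" "j \<le> n + 2" "0 < i \<or> j < n + 2"
  using subsetD[OF triangulation_subset[OF assms(1)] assms(2)] by (auto simp: diagonals_def)

lemma edge_bounds:
  assumes "T \<in> triangulations n" "edge n T i j"
  shows "i < j" "j \<le> n + 2"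
  using assms(2) in_triangulation[OF assms(1), of i j] by (auto simp: edge_def)

lemma edge_in:
  assumes "edge n T i j" "i + 1 < j" "0 < i \<or> j < n + 2"
  shows "(i, j) \<in> T"
  using assms by (auto simp: edge_def)

lemma edge_noncrossing:
  assumes "T \<in> triangulations n" "edge n T i j" "edge n T k l"
  shows "\<not> (i < k \<and> k < j \<and> j < l)"
proof
  assume c: "i < k \<and> k < j \<and> j < l"
  have "(i, j) \<in> T"
    using edge_bounds(2)[OF assms(1,3)] c assms(2) by (intro edge_in) auto
  moreover have "(k, l) \<in> T"
    using c assms(3) by (intro edge_in) auto
  ultimately show False
    using triangulation_noncrossing[OF assms(1)] c by fastforce
qed

lemma edge_complete:
  assumes T: "T \<in> triangulations n" and "i < j" "j \<le> n + 2"
    and nc: "\<And>k l. edge n T k l \<Longrightarrow> \<not> crossing (i, j) (k, l)"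
  shows "edge n T i j"
proof (cases "j = Suc i \<or> (i = 0 \<and> j = n + 2)")
  case True
  then show ?thesis using assms by (auto simp: edge_def)
next
  case False
  have "insert (i, j) T \<in> noncrossing_complex n"
  proof -
    have "\<not> crossing (i, j) e \<and> \<not> crossing e (i, j)" if "e \<in> T" for e
      using nc[of "fst e" "snd e"] that crossing_sym by (auto simp: edge_def)
    moreover have "(i, j) \<in> diagonals (n + 3)"
      using False assms(2,3) by (auto simp: diagonals_def)
    ultimately show ?thesis
      using triangulation_subset[OF T] triangulation_noncrossing[OF T] not_crossing_self
      unfolding noncrossing_complex_def by blast
  qed
  then have "insert (i, j) T = T"
    using T by (auto simp: maximal_simplices_def)
  then show ?thesis by (auto simp: edge_def)
qed

text \<open>Take b to be the largest neighbour of a below c. An edge crossing bc would cross ac or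
  ab, or would join a to a neighbour beyond b; so bc is uncrossed and belongs to T by
  maximality.\<close>

lemma apex_exists:
  assumes T: "T \<in> triangulations n" and ac: "edge n T a c" "Suc a < c"
  obtains b where "a < b" "b < c" "edge n T a b" "edge n T b c"
proof -
  define B where "B = {b. b < c \<and> edge n T a b}"
  have c: "c \<le> n + 2" using edge_bounds[OF T ac(1)] by simp
  have "finite B" "Suc a \<in> B" using ac c by (auto simp: B_def edge_def)
  define b where "b = Max B"
  have b: "b \<in> B" "\<And>x. x \<in> B \<Longrightarrow> x \<le> b"
    unfolding b_def using \<open>finite B\<close> \<open>Suc a \<in> B\<close> by (blast intro: Max_in, simp)
  then have ab: "b < c" "edge n T a b" "a < b" by (auto simp: B_def edge_bounds[OF T])
  have "edge n T b c"
  proof (rule edge_complete[OF T ab(1) c])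
    fix k l assume kl: "edge n T k l"
    show "\<not> crossing (b, c) (k, l)"
    proof
      assume "crossing (b, c) (k, l)"
      then consider "b < k" "k < c" "c < l" | "k < b" "b < l" "l < c" by auto
      then show False
      proof cases
        case 1
        then show False using edge_noncrossing[OF T ac(1) kl] ab by simp
      next
        case 2
        then have "\<not> k < a" using edge_noncrossing[OF T kl ac(1)] ab by simp
        moreover have "\<not> a < k" using edge_noncrossing[OF T ab(2) kl] 2 by simp
        ultimately have "k = a" by simp
        then have "l \<in> B" using kl 2 by (simp add: B_def)
        then show False using b(2) 2 by fastforce
      qed
    qed
  qed
  then show ?thesis using ab that by blast
qed

lemma apex_unique:
  assumes T: "T \<in> triangulations n"
    and "edge n T a b" "edge n T b c" "edge n T a b'" "edge n T b' c"
  shows "b = b'"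
proof -
  note e = assms(2-)
  have "\<not> b < b'" "\<not> b' < b"
    using edge_noncrossing[OF T e(3) e(2)] edge_noncrossing[OF T e(1) e(4)]
      edge_bounds[OF T e(1)] edge_bounds[OF T e(2)] edge_bounds[OF T e(3)] edge_bounds[OF T e(4)]
    by auto
  then show ?thesis by simp
qed

text \<open>The shortest edge strictly above ac has an apex outside the open interval between a and
  c, since otherwise one of its triangle sides would cross ac. The triangle side above ac is then ac
  itself, by minimality.\<close>

lemma parent_exists:
  assumes T: "T \<in> triangulations n" and ac: "edge n T a c" "(a, c) \<noteq> (0, n + 2)"
  obtains x where "x < a" "edge n T x a" "edge n T x c" | x where "c < x" "edge n T a x" "edge n T c x"
proof -
  let ?P = "\<lambda>(x, y). edge n T x y \<and> x \<le> a \<and> c \<le> y \<and> (x, y) \<noteq> (a, c)"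
  note acb = edge_bounds[OF T ac(1)]
  have "?P (0, n + 2)" using acb ac by (auto simp: edge_def)
  from ex_has_least_nat[of ?P, OF this, of "\<lambda>(x, y). y - x"]
  obtain x y where xy: "edge n T x y" "x \<le> a" "c \<le> y" "(x, y) \<noteq> (a, c)"
    and least: "\<And>u v. \<lbrakk>edge n T u v; u \<le> a; c \<le> v; (u, v) \<noteq> (a, c)\<rbrakk> \<Longrightarrow> y - x \<le> v - u"
    by auto
  have "x < a \<or> c < y" using xy by auto
  then have "Suc x < y" using xy acb by linarith
  then obtain b where b: "x < b" "b < y" "edge n T x b" "edge n T b y"
    using apex_exists[OF T xy(1)] by blast
  have "\<not> (a < b \<and> b < c)"
  proof
    assume h: "a < b \<and> b < c"
    show False
    proof (cases "x < a")
      case True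
      then show False using edge_noncrossing[OF T b(3) ac(1)] h by simp
    next
      case False
      then show False using edge_noncrossing[OF T ac(1) b(4)] h xy by auto
    qed
  qed
  then consider "b \<le> a" | "c \<le> b" by linarith
  then show ?thesis
  proof cases
    case 1
    then have "(b, y) = (a, c)"
      using least[of b y] b xy by fastforce
    then show ?thesis using that(1)[of x] b xy by auto
  next
    case 2
    then have "(x, b) = (a, c)"
      using least[of x b] b xy by fastforce
    then show ?thesis using that(2)[of y] b xy by auto
  qed
qed

text \<open>Sending an edge to the apex of the triangle below it is a bijection from the diagonals,
  together with the root side \<open>(0, n + 2)\<close>, onto the vertices \<open>1, \<dots>, n + 1\<close>.\<close>

lemma card_triangulation:
  assumes T: "T \<in> triangulations n"
  shows "card T = n"
proof -
  let ?D = "insert (0, n + 2) T"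
  let ?P = "\<lambda>e b. edge n T (fst e) b \<and> edge n T b (snd e)"
  define f where "f e = (SOME b. ?P e b)" for e
  have f: "?P e (f e)" if "e \<in> ?D" for e
  proof -
    have "edge n T (fst e) (snd e)" "Suc (fst e) < snd e"
      using that in_triangulation(1)[OF T, of "fst e" "snd e"] by (auto simp: edge_def)
    then have "\<exists>b. ?P e b" using apex_exists[OF T] by blast
    then show ?thesis unfolding f_def by (rule someI_ex)
  qed
  have "inj_on f ?D"
  proof (rule inj_onI)
    fix e e' assume e: "e \<in> ?D" "e' \<in> ?D" "f e = f e'"
    obtain i j k l where ij: "e = (i, j)" "e' = (k, l)" by (cases e; cases e') auto
    have E: "edge n T i j" "edge n T k l" using e ij by (auto simp: edge_def)
    define b where "b = f e"
    have b: "edge n T i b" "edge n T b j" "edge n T k b" "edge n T b l"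
      using f[OF e(1)] f[OF e(2)] e(3) ij by (auto simp: b_def)
    note bb = b[THEN edge_bounds(1)[OF T]]
    have "i = k" "j = l"
      using edge_noncrossing[OF T b(1) E(2)] edge_noncrossing[OF T b(3) E(1)]
        edge_noncrossing[OF T E(1) b(4)] edge_noncrossing[OF T E(2) b(2)] bb by auto
    then show "e = e'" using ij by simp
  qed
  moreover have "f ` ?D = {1..n + 1}"
  proof (intro subset_antisym subsetI)
    fix b assume "b \<in> f ` ?D"
    then obtain e where "e \<in> ?D" "b = f e" by auto
    with f[of e] show "b \<in> {1..n + 1}"
      using edge_bounds[OF T, of "fst e" b] edge_bounds[OF T, of b "snd e"] by auto
  next
    fix b assume b: "b \<in> {1..n + 1}"
    \<comment> \<open>Choose the shortest edge passing over b. If its apex were not b, one of the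
      two edges to the apex would pass over b and be shorter.\<close>
    let ?Q = "\<lambda>(x, y). edge n T x y \<and> x < b \<and> b < y"
    have "?Q (0, n + 2)" using b by (auto simp: edge_def)
    from ex_has_least_nat[of ?Q, OF this, of "\<lambda>(x, y). y - x"]
    obtain x y where xy: "edge n T x y" "x < b" "b < y"
      and least: "\<And>u v. \<lbrakk>edge n T u v; u < b; b < v\<rbrakk> \<Longrightarrow> y - x \<le> v - u"
      by auto
    have D: "(x, y) \<in> ?D" using xy by (auto simp: edge_def)
    define z where "z = f (x, y)"
    have z: "edge n T x z" "edge n T z y" using f[OF D] by (auto simp: z_def)
    have "z = b"
      using least[OF z(1)] least[OF z(2)] edge_bounds[OF T z(1)] edge_bounds[OF T z(2)] xy by force
    then show "b \<in> f ` ?D" using D z_def by blast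
  qed
  ultimately have "card ?D = n + 1"
    using card_image[of f ?D] by simp
  moreover have "(0, n + 2) \<notin> T"
    using in_triangulation[OF T, of 0 "n + 2"] by auto
  ultimately show ?thesis
    using triangulation_finite[OF T] by simp
qed

text \<open>The complex is pure. This replaces maximality by a count, which is easy to check for a
  set obtained by exchanging one diagonal.\<close>

lemma triangulation_iff_card:
  "T \<in> triangulations n \<longleftrightarrow> T \<in> noncrossing_complex n \<and> card T = n"
proof
  assume "T \<in> noncrossing_complex n \<and> card T = n"
  moreover then obtain U where U: "U \<in> triangulations n" "T \<subseteq> U"
    using triangulation_extending by blast
  ultimately have "T = U"
    using card_triangulation[OF U(1)] triangulation_finite[OF U(1)] card_subset_eq by metis
  then show "T \<in> triangulations n" using U by simp
qed (auto simp: card_triangulation, auto simp: maximal_simplices_def)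

section \<open>Flips\<close>

text \<open>Of the two diagonals of a quadrilateral exactly one contains the least corner; this
  orients every flip. The edge \<open>bd\<close> is included, so the predicate says that the down
  flip is available in T.\<close>

definition down_quad :: "nat \<Rightarrow> (nat \<times> nat) set \<Rightarrow> nat \<Rightarrow> nat \<Rightarrow> nat \<Rightarrow> nat \<Rightarrow> bool" where
  "down_quad n T a b c d \<longleftrightarrow> a < b \<and> b < c \<and> c < d \<and>
     edge n T a b \<and> edge n T b c \<and> edge n T c d \<and> edge n T a d \<and> edge n T b d"

definition down_flip :: "nat \<Rightarrow> nat \<Rightarrow> nat \<Rightarrow> nat \<Rightarrow> (nat \<times> nat) set \<Rightarrow> (nat \<times> nat) set" where
  "down_flip a b c d T = insert (a, c) (T - {(b, d)})"

lemma down_quadD: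
  assumes "down_quad n T a b c d"
  shows "a < b" "b < c" "c < d" "edge n T a b" "edge n T b c" "edge n T c d" "edge n T a d" "edge n T b d"
  using assms by (auto simp: down_quad_def)

text \<open>A chord that enters the quadrilateral without crossing a side must do so at corners,
  hence is a diagonal.\<close>

lemma crossing_quad_diagonal:
  assumes "a < b" "b < c" "c < (d :: nat)" "x < y"
    and "\<not> crossing (a, b) (x, y)" "\<not> crossing (b, c) (x, y)"
      "\<not> crossing (c, d) (x, y)" "\<not> crossing (a, d) (x, y)"
  shows "crossing (a, c) (x, y) \<Longrightarrow> (x, y) = (b, d)" "crossing (b, d) (x, y) \<Longrightarrow> (x, y) = (a, c)"
  using assms by (simp; linarith)+

lemma edge_not_crossing:
  assumes "T \<in> triangulations n" "edge n T i j" "edge n T k l"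
  shows "\<not> crossing (i, j) (k, l)"
  using edge_noncrossing[OF assms] edge_noncrossing[OF assms(1,3,2)] by auto

context
  fixes n T a b c d
  assumes T: "T \<in> triangulations n" and Q: "down_quad n T a b c d"
begin

lemma quad_bound: "d \<le> n + 2"
  using edge_bounds(2)[OF T down_quadD(8)[OF Q]] .

lemma quad_diagonals: "(b, d) \<in> T" "(a, c) \<notin> T"
proof -
  show "(b, d) \<in> T"
    using down_quadD[OF Q] by (intro edge_in) auto
  then show "(a, c) \<notin> T"
    using triangulation_noncrossing[OF T, of "(a, c)" "(b, d)"] down_quadD[OF Q] by auto
qed

lemma not_edge_diagonal: "\<not> edge n T a c"
  using edge_noncrossing[OF T, of a c b d] down_quadD[OF Q] by auto

lemma edge_down_flip:
  "edge n (down_flip a b c d T) i j \<longleftrightarrow> edge n T i j \<and> (i, j) \<noteq> (b, d) \<or> (i, j) = (a, c)"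
  using down_quadD(1-3)[OF Q] quad_bound by (auto simp: edge_def down_flip_def)

text \<open>The only diagonal of T crossed by \<open>ac\<close> is the removed one, so the new set
  is noncrossing; maximality follows from the unchanged cardinality.\<close>

lemma down_flip_triangulation: "down_flip a b c d T \<in> triangulations n"
proof -
  note q = down_quadD[OF Q]
  have fin: "finite T" by (rule triangulation_finite[OF T])
  have nc: "\<not> crossing (a, c) e" if "e \<in> T - {(b, d)}" for e
  proof -
    obtain x y where e: "e = (x, y)" by (cases e)
    then have xy: "edge n T x y" using that by (auto simp: edge_def)
    show ?thesis
      using crossing_quad_diagonal(1)[OF q(1-3) edge_bounds(1)[OF T xy]
          edge_not_crossing[OF T q(4) xy] edge_not_crossing[OF T q(5) xy]
          edge_not_crossing[OF T q(6) xy] edge_not_crossing[OF T q(7) xy]] that e by blast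
  qed
  have "(a, c) \<in> diagonals (n + 3)"
    using q(1-3) quad_bound by (auto simp: diagonals_def)
  then have "down_flip a b c d T \<subseteq> diagonals (n + 3)"
    using triangulation_subset[OF T] by (auto simp: down_flip_def)
  moreover have "\<not> crossing e f" if "e \<in> down_flip a b c d T" "f \<in> down_flip a b c d T" for e f
    using that nc[of e] nc[of f] triangulation_noncrossing[OF T, of e f] not_crossing_self
      crossing_sym[of e f]
    unfolding down_flip_def by blast
  ultimately have "down_flip a b c d T \<in> noncrossing_complex n"
    by (simp add: noncrossing_complex_def)
  moreover have "card (down_flip a b c d T) = n"
  proof -
    have "card T > 0" using fin quad_diagonals(1) card_gt_0_iff by blast
    then show ?thesis
      using fin quad_diagonals card_triangulation[OF T]
      by (simp add: down_flip_def card_insert_if card_Diff_singleton)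
  qed
  ultimately show ?thesis by (simp add: triangulation_iff_card)
qed

lemma down_flip_diffs: "T - down_flip a b c d T = {(b, d)}" "down_flip a b c d T - T = {(a, c)}"
  using quad_diagonals down_quadD(1-3)[OF Q] by (auto simp: down_flip_def)

text \<open>Because a + c < b + d, the sum of all end points decreases. It is the induction measure
  wherever down flips are iterated.\<close>

lemma down_flip_measure:
  "(\<Sum>(i, j)\<in>down_flip a b c d T. i + j) < (\<Sum>(i, j)\<in>T. i + j)"
proof -
  have fin: "finite T" by (rule triangulation_finite[OF T])
  have "(\<Sum>(i, j)\<in>T. i + j) = b + d + (\<Sum>(i, j)\<in>T - {(b, d)}. i + j)"
    using sum.remove[OF fin quad_diagonals(1), of "\<lambda>(i, j). i + j"] by simp
  moreover have "(\<Sum>(i, j)\<in>down_flip a b c d T. i + j) = a + c + (\<Sum>(i, j)\<in>T - {(b, d)}. i + j)"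
    using fin quad_diagonals(2) by (simp add: down_flip_def)
  ultimately show ?thesis using down_quadD(1-3)[OF Q] by simp
qed

end

section \<open>Nearness as the exchange of two crossing diagonals\<close>

abbreviation flip_near :: "nat \<Rightarrow> (nat \<times> nat) set \<Rightarrow> (nat \<times> nat) set \<Rightarrow> bool" where
  "flip_near n \<equiv> q_near (noncrossing_complex n) (n - 2)"

text \<open>A face of dimension n - 2 has n - 1 vertices, and every subset of the intersection is a
  face. The bound on n makes \<open>n - 2 + 1\<close> equal to \<open>n - 1\<close> in truncated
  subtraction.\<close>

lemma flip_near_iff:
  assumes "n \<ge> 2" "x \<in> triangulations n" "y \<in> triangulations n"
  shows "flip_near n x y \<longleftrightarrow> n - 1 \<le> card (x \<inter> y)"
proof
  assume "flip_near n x y"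
  then obtain \<rho> where "card \<rho> = n - 2 + 1" "\<rho> \<subseteq> x \<inter> y"
    by (auto simp: q_near_def)
  then show "n - 1 \<le> card (x \<inter> y)"
    using card_mono[of "x \<inter> y" \<rho>] triangulation_finite[OF assms(2)] assms(1) by simp
next
  assume "n - 1 \<le> card (x \<inter> y)"
  then obtain \<rho> where "\<rho> \<subseteq> x \<inter> y" "card \<rho> = n - 1"
    by (meson obtain_subset_with_card_n)
  moreover then have "\<rho> \<in> noncrossing_complex n"
    using noncrossing_complex_mono[of x n \<rho>] assms(2) by (auto simp: maximal_simplices_def)
  moreover have "n - 1 = n - 2 + 1" using assms(1) by simp
  ultimately show "flip_near n x y"
    unfolding q_near_def by (metis le_inf_iff)
qed

lemma flip_near_refl: "n \<ge> 2 \<Longrightarrow> x \<in> triangulations n \<Longrightarrow> flip_near n x x"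
  by (simp add: flip_near_iff card_triangulation)

lemma near_down_flip:
  assumes "n \<ge> 2" "T \<in> triangulations n" "down_quad n T a b c d"
  shows "flip_near n T (down_flip a b c d T)"
proof -
  have "T - {(b, d)} \<subseteq> T \<inter> down_flip a b c d T"
    by (auto simp: down_flip_def)
  from card_mono[OF _ this] show ?thesis
    using assms quad_diagonals(1)[OF assms(2,3)] triangulation_finite[OF assms(2)]
    by (simp add: flip_near_iff down_flip_triangulation card_Diff_singleton card_triangulation)
qed

text \<open>If the exchanged diagonals did not cross, adding the new one to x would give a larger
  noncrossing set, against maximality.\<close>

lemma near_exchange:
  assumes "n \<ge> 2" and x: "x \<in> triangulations n" and y: "y \<in> triangulations n"
    and "flip_near n x y" "x \<noteq> y"
  obtains p q where "x - y = {p}" "y - x = {q}" "crossing p q"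
proof -
  have fin: "finite x" "finite y" using x y triangulation_finite by auto
  have c: "card x = n" "card y = n" using x y card_triangulation by auto
  have le: "n - 1 \<le> card (x \<inter> y)" using flip_near_iff assms by blast
  have "card (x \<inter> y) < n"
  proof (rule ccontr)
    assume "\<not> ?thesis"
    then have "x \<inter> y = x" "x \<inter> y = y"
      using card_seteq[OF fin(1), of "x \<inter> y"] card_seteq[OF fin(2), of "x \<inter> y"] c by auto
    then show False using assms(5) by simp
  qed
  then have "card (x \<inter> y) = n - 1" using le by simp
  then have "card (x - y) = 1" "card (y - x) = 1"
    using card_Diff_subset_Int[of x y] card_Diff_subset_Int[of y x] fin c assms(1) by (auto simp: Int_commute)
  then obtain p q where pq: "x - y = {p}" "y - x = {q}" by (auto simp: card_1_singleton_iff)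
  have "crossing p q"
  proof (rule ccontr)
    assume nc: "\<not> crossing p q"
    have "\<not> crossing d e" if "d \<in> insert q x" "e \<in> insert q x" for d e
    proof -
      have "x \<subseteq> insert p y" "q \<in> y" using pq by auto
      then show ?thesis
        using that nc triangulation_noncrossing[OF x] triangulation_noncrossing[OF y] crossing_sym
        by (metis insertE not_crossing_self subsetD)
    qed
    moreover have "insert q x \<subseteq> diagonals (n + 3)"
      using pq triangulation_subset[OF x] triangulation_subset[OF y] by blast
    ultimately have "insert q x \<in> noncrossing_complex n"
      unfolding noncrossing_complex_def by blast
    then have "insert q x = x" using x by (auto simp: maximal_simplices_def)
    then show False using pq by auto
  qed
  then show ?thesis using that pq by blast
qed

text \<open>A chord crossing a side of the quadrilateral spanned by the two exchanged diagonals
  crosses one of these diagonals as well. The common part of x and y crosses neither, so all four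
  sides are uncrossed and hence are edges.\<close>

lemma exchange_quad:
  assumes x: "x \<in> triangulations n" and y: "y \<in> triangulations n"
    and d: "x - y = {(b, d)}" "y - x = {(a, c)}" and o: "a < b" "b < c" "c < d"
  shows "down_quad n x a b c d" "y = down_flip a b c d x"
proof -
  have d': "(b, d) \<in> x" "(a, c) \<in> y" using d by auto
  then have db: "d \<le> n + 2" using in_triangulation x by blast
  have side: "edge n x i j"
    if ij: "i < j" "j \<le> n + 2"
      and cr: "\<And>k l. k < l \<Longrightarrow> crossing (i, j) (k, l) \<Longrightarrow> crossing (a, c) (k, l) \<or> crossing (b, d) (k, l)"
      and nc: "\<not> crossing (i, j) (b, d)" for i j
  proof (rule edge_complete[OF x ij])
    fix k l assume kl: "edge n x k l"
    show "\<not> crossing (i, j) (k, l)"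
    proof
      assume h: "crossing (i, j) (k, l)"
      have "(k, l) \<in> x"
        using h kl ij edge_bounds(1)[OF x kl] by (intro edge_in[OF kl]) auto
      moreover have "(k, l) \<noteq> (b, d)" using h nc by auto
      ultimately have "(k, l) \<in> x \<inter> y" using d by blast
      then have "\<not> crossing (a, c) (k, l)" "\<not> crossing (b, d) (k, l)"
        using d' triangulation_noncrossing[OF x] triangulation_noncrossing[OF y] by blast+
      then show False using cr[OF edge_bounds(1)[OF x kl] h] by blast
    qed
  qed
  show "down_quad n x a b c d"
    unfolding down_quad_def
  proof (intro conjI o)
    show "edge n x b d" using d' by (simp add: edge_def)
  qed (rule side; use o db in \<open>simp; linarith?\<close>)+
  show "y = down_flip a b c d x"
    using d by (auto simp: down_flip_def)
qed

lemma near_cases: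
  assumes n: "n \<ge> 2" and x: "x \<in> triangulations n" and y: "y \<in> triangulations n" and near: "flip_near n x y"
  obtains "x = y"
  | a b c d where "down_quad n x a b c d" "y = down_flip a b c d x"
  | a b c d where "down_quad n y a b c d" "x = down_flip a b c d y"
proof (cases "x = y")
  case False
  obtain p q where pq: "x - y = {p}" "y - x = {q}" "crossing p q"
    using near_exchange[OF n x y near False] .
  obtain i j k l where ij: "p = (i, j)" "q = (k, l)" by fastforce
  have "crossing (i, j) (k, l)" using pq(3) ij by simp
  then consider "i < k" "k < j" "j < l" | "k < i" "i < l" "l < j" by auto
  then show ?thesis
  proof cases
    case 1
    show ?thesis
      by (rule that(3)[OF exchange_quad[OF y x _ _ 1]]) (use pq(1,2) ij in simp_all)
  next
    case 2
    show ?thesis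
      by (rule that(2)[OF exchange_quad[OF x y _ _ 2]]) (use pq(1,2) ij in simp_all)
  qed
qed (rule that(1))

text \<open>A diagonal crossing both diagonals of a quadrilateral crosses one of its sides, so removing a
  diagonal from a triangulation leaves only two completions.\<close>

lemma exchange_unique:
  assumes x: "x \<in> triangulations n"
    and y: "y \<in> triangulations n" "x - y = {p}" "y - x = {q}"
    and z: "z \<in> triangulations n" "x - z = {p}" "z - x = {r}"
    and "crossing p q" "crossing p r"
  shows "q = r"
proof -
  obtain i j k l u v where ij: "p = (i, j)" "q = (k, l)" "r = (u, v)" by fastforce
  have uv: "(u, v) \<in> z" using z ij by auto
  then have uvlt: "u < v" using in_triangulation(1)[OF z(1) uv] by simp
  have side: "\<not> crossing (s, t) (u, v)" if "edge n x s t" "(s, t) \<noteq> p" for s t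
  proof -
    have "edge n z s t" using that z by (auto simp: edge_def)
    then show ?thesis
      using edge_not_crossing[OF z(1), of s t u v] uv by (simp add: edge_def)
  qed
  have "crossing (i, j) (k, l)" using assms(8) ij by simp
  then consider "i < k" "k < j" "j < l" | "k < i" "i < l" "l < j" by auto
  then show ?thesis
  proof cases
    case 1
    have "down_quad n y i k j l"
      by (rule exchange_quad(1)[OF y(1) x _ _ 1]) (use y(2,3) ij in simp_all)
    moreover have "edge n x s t" if "edge n y s t" "(s, t) \<noteq> q" for s t
      using that y by (auto simp: edge_def)
    ultimately have "down_quad n y i k j l" "edge n x i k" "edge n x k j" "edge n x j l" "edge n x i l"
      using 1 ij by (auto simp: down_quad_def)
    then have "(u, v) = (k, l)"
      by (intro crossing_quad_diagonal(1)[OF 1 uvlt] side) (use 1 ij assms(9) in auto)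
    then show ?thesis using ij by simp
  next
    case 2
    have "down_quad n x k i l j"
      by (rule exchange_quad(1)[OF x y(1) _ _ 2]) (use y(2,3) ij in simp_all)
    then have "(u, v) = (k, l)"
      by (intro crossing_quad_diagonal(2)[OF 2 uvlt] side) (use 2 ij assms(9) in \<open>auto simp: down_quad_def\<close>)
    then show ?thesis using ij by simp
  qed
qed

text \<open>If both flips of x remove the same diagonal, \<open>exchange_unique\<close> identifies
  the results. If they remove different ones, z keeps p, and nearness of y and z forces q into z
  too, although p and q cross. So three-cycles impose no relation on loops.\<close>

lemma no_flip_triangle:
  assumes n: "n \<ge> 2" and x: "x \<in> triangulations n" and y: "y \<in> triangulations n" and z: "z \<in> triangulations n"
    and near: "flip_near n x y" "flip_near n x z" "flip_near n y z"
  shows "x = y \<or> x = z \<or> y = z"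
proof (rule ccontr)
  assume "\<not> ?thesis"
  then have ne: "x \<noteq> y" "x \<noteq> z" "y \<noteq> z" by auto
  obtain p q where pq: "x - y = {p}" "y - x = {q}" "crossing p q"
    using near_exchange[OF n x y near(1) ne(1)] .
  obtain p' r where pr: "x - z = {p'}" "z - x = {r}" "crossing p' r"
    using near_exchange[OF n x z near(2) ne(2)] .
  obtain u v where uv: "y - z = {u}" "z - y = {v}"
    using near_exchange[OF n y z near(3) ne(3)] .
  have yz: "y = insert q (x - {p})" "z = insert r (x - {p'})" using pq(1,2) pr(1,2) by blast+
  have mem: "p \<in> x" "q \<notin> x" "p' \<in> x" "r \<notin> x" using pq(1,2) pr(1,2) by blast+
  show False
  proof (cases "p = p'")
    case True
    then have "q = r" using exchange_unique[OF x y pq(1,2) z _ pr(2)] pq(3) pr by simp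
    then show False using ne(3) yz True by simp
  next
    case False
    then have "p' \<in> y" "p' \<notin> z" "q \<noteq> p'" "p \<in> z" "q \<in> y" using yz mem by auto
    then have "q \<in> z" using uv(1) by (metis DiffI singletonD)
    then show False using \<open>p \<in> z\<close> pq(3) triangulation_noncrossing[OF z] by metis
  qed
qed

section \<open>Four-cycles of the flip graph\<close>

lemma near_if_common:
  assumes "n \<ge> 2" "x \<in> triangulations n" "y \<in> triangulations n" "R \<subseteq> x" "R \<subseteq> y" "card R = n - 1"
  shows "flip_near n x y"
proof -
  have "card R \<le> card (x \<inter> y)"
    using assms triangulation_finite by (intro card_mono) auto
  then show ?thesis using assms by (simp add: flip_near_iff)
qed

text \<open>The second flip cannot remove the diagonal just inserted, since x and z would then be
  near. It cannot restore p either, which crosses the surviving q. Hence x and z differ by two full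
  exchanges.\<close>

lemma two_flips:
  assumes n: "n \<ge> 2" and x: "x \<in> triangulations n" and y: "y \<in> triangulations n" and z: "z \<in> triangulations n"
    and near: "flip_near n x y" "flip_near n y z" and ne: "x \<noteq> z" and far: "\<not> flip_near n x z"
  obtains p q u v where "x - y = {p}" "y - x = {q}" "y - z = {u}" "z - y = {v}"
    "x - z = {p, u}" "z - x = {q, v}" "p \<noteq> u" "q \<noteq> v"
proof -
  have ne': "x \<noteq> y" "y \<noteq> z" using near far by auto
  obtain p q where pq: "x - y = {p}" "y - x = {q}" "crossing p q"
    using near_exchange[OF n x y near(1) ne'(1)] .
  obtain u v where uv: "y - z = {u}" "z - y = {v}"
    using near_exchange[OF n y z near(2) ne'(2)] .
  have yz: "y = insert q (x - {p})" "z = insert v (y - {u})" using pq(1,2) uv by blast+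
  have mem: "p \<in> x" "q \<notin> x" "u \<in> y" "v \<notin> y" using pq(1,2) uv by blast+
  have "u \<noteq> q"
  proof
    assume "u = q"
    then have "x - {p} \<subseteq> z" using yz mem by auto
    then show False
      using near_if_common[OF n x z, of "x - {p}"] far mem card_triangulation[OF x]
        triangulation_finite[OF x] by (simp add: card_Diff_singleton)
  qed
  then have "q \<in> z" using yz by simp
  moreover have "v \<in> z" using yz by simp
  ultimately have "v \<noteq> p" using pq(3) triangulation_noncrossing[OF z] by metis
  show ?thesis
    by (rule that[OF pq(1,2) uv]) (use yz mem \<open>u \<noteq> q\<close> \<open>v \<noteq> p\<close> in auto)
qed

text \<open>The equations say that \<open>x, y, z, t\<close> bound a square of two commuting flips.\<close>

lemma flip_square:
  assumes n: "n \<ge> 2" and tri: "x \<in> triangulations n" "y \<in> triangulations n"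
    "z \<in> triangulations n" "t \<in> triangulations n"
    and near: "flip_near n x y" "flip_near n y z" "flip_near n x t" "flip_near n t z"
    and ne: "x \<noteq> z" "y \<noteq> t"
  shows "x - y = t - z \<and> y - x = z - t \<and> y - z = x - t \<and> z - y = t - x"
proof (cases "flip_near n x z")
  case True
  have "x = y \<or> y = z"
    using no_flip_triangle[OF n tri(1,2,3) near(1) True near(2)] ne by auto
  moreover have "x = t \<or> t = z"
    using no_flip_triangle[OF n tri(1,4,3) near(3) True near(4)] ne by auto
  ultimately show ?thesis using ne by auto
next
  case False
  have distinct: "x \<noteq> y" "y \<noteq> z" "x \<noteq> t" "t \<noteq> z"
    using near False by auto
  obtain p q u v where 1: "x - y = {p}" "y - x = {q}" "y - z = {u}" "z - y = {v}"
    "x - z = {p, u}" "z - x = {q, v}" "p \<noteq> u" "q \<noteq> v"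
    using two_flips[OF n tri(1-3) near(1,2) ne(1) False] .
  obtain p' q' u' v' where 2: "x - t = {p'}" "t - x = {q'}" "t - z = {u'}" "z - t = {v'}"
    "x - z = {p', u'}" "z - x = {q', v'}" "p' \<noteq> u'" "q' \<noteq> v'"
    using two_flips[OF n tri(1,4,3) near(3,4) ne(1) False] .
  have mem: "p \<in> x" "q \<notin> x" "u \<in> x" using 1(1,2,5) by blast+
  have y: "y = insert q (x - {p})" using 1(1,2) by blast
  have t: "t = insert q' (x - {p'})" using 2(1,2) by blast
  have fin: "finite x" and c: "card x = n"
    using triangulation_finite card_triangulation tri by auto
  \<comment> \<open>Both routes remove the same two diagonals and insert the same two. Among the
    ways of matching them only the one with both orders reversed survives: in every other case y and
    t share n - 1 diagonals, are near, and complete a triangle.\<close>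
  have "p = p' \<and> u = u' \<or> p = u' \<and> u = p'"
    using 1(5) 2(5) by (auto simp: doubleton_eq_iff)
  moreover have "q = q' \<and> v = v' \<or> q = v' \<and> v = q'"
    using 1(6) 2(6) by (auto simp: doubleton_eq_iff)
  moreover have "p \<noteq> p'"
  proof
    assume "p = p'"
    then have "flip_near n y t"
      using mem fin c y t by (intro near_if_common[OF n tri(2,4), of "x - {p}"]) (auto simp: card_Diff_singleton)
    then show False
      using no_flip_triangle[OF n tri(1,2,4) near(1,3)] distinct ne by auto
  qed
  moreover have "\<not> (p = u' \<and> u = p' \<and> q = q')"
  proof
    assume h: "p = u' \<and> u = p' \<and> q = q'"
    have "card (x - {p, u}) = n - 2" using mem fin c 1(7) by (simp add: card_Diff_subset)
    then have "card (insert q (x - {p, u})) = n - 1" using mem fin n by simp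
    then have "flip_near n y t"
      using y t h by (intro near_if_common[OF n tri(2,4), of "insert q (x - {p, u})"]) auto
    then show False
      using no_flip_triangle[OF n tri(2,4,3) _ near(2,4)] distinct ne by auto
  qed
  ultimately have "p = u'" "u = p'" "q = v'" "v = q'" by auto
  then show ?thesis using 1(1-4) 2(1-4) by simp
qed

section \<open>Disjoint flips and pentagons\<close>

text \<open>These are the edges required by \<open>down_quad\<close>. A flip removing
  \<open>qs\<close> leaves the flip in \<open>abcd\<close> available when \<open>qs\<close> is not
  among them, which is how disjointness of quadrilaterals is expressed below.\<close>

definition quad_edges :: "nat \<Rightarrow> nat \<Rightarrow> nat \<Rightarrow> nat \<Rightarrow> (nat \<times> nat) set" where
  "quad_edges a b c d = {(a, b), (b, c), (c, d), (a, d), (b, d)}"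

text \<open>Overlapping quadrilaterals have a triangle of T in common, and then each contains the
  removed diagonal of the other. So disjointness is symmetric.\<close>

lemma quad_edges_sym:
  assumes T: "T \<in> triangulations n" and Q: "down_quad n T a b c d" and P: "down_quad n T p q r s"
    and "(q, s) \<notin> quad_edges a b c d"
  shows "(b, d) \<notin> quad_edges p q r s"
proof
  assume "(b, d) \<in> quad_edges p q r s"
  note Q' = down_quadD[OF Q] and P' = down_quadD[OF P]
  note ne = assms(4)[unfolded quad_edges_def, simplified]
  have "(b, d) \<noteq> (p, s)"
    using apex_unique[OF T Q'(5,6), of q] P' ne by auto
  moreover have "(b, d) \<noteq> (q, r)" "(b, d) \<noteq> (p, q)"
    using edge_noncrossing[OF T Q'(7), of b s] P' Q'(1-3) by auto
  moreover have "(b, d) \<noteq> (r, s)"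
  proof
    assume h: "(b, d) = (r, s)"
    then have "q < a \<or> a < q" using ne by auto
    then show False
      using edge_noncrossing[OF T P'(5) Q'(7)] edge_noncrossing[OF T Q'(4) P'(8)] h P'(1-3) Q'(1-3) by auto
  qed
  ultimately show False
    using \<open>(b, d) \<in> quad_edges p q r s\<close> ne by (auto simp: quad_edges_def)
qed

lemma down_quad_after_flip:
  assumes T: "T \<in> triangulations n" and Q: "down_quad n T a b c d" and P: "down_quad n T p q r s"
    and "(b, d) \<notin> quad_edges p q r s"
  shows "down_quad n (down_flip a b c d T) p q r s"
  using P assms(4) by (auto simp: down_quad_def quad_edges_def edge_down_flip[OF T Q])

lemma down_flips_commute:
  assumes T: "T \<in> triangulations n" and Q: "down_quad n T a b c d" and P: "down_quad n T p q r s"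
  shows "down_flip p q r s (down_flip a b c d T) = down_flip a b c d (down_flip p q r s T)"
  using quad_diagonals[OF T Q] quad_diagonals[OF T P] by (auto simp: down_flip_def)

context
  fixes n T a b c d
  assumes T: "T \<in> triangulations n" and Q: "down_quad n T a b c d"
    and root: "0 < a" "edge n T 0 a" "edge n T 0 d"
begin

text \<open>The pentagon \<open>0abcd\<close> starts with the diagonals \<open>ad\<close> and
  \<open>bd\<close>. Two chains of down flips end at \<open>0b\<close> and \<open>0c\<close>: the
  short one replaces \<open>ad\<close> by \<open>0b\<close> and \<open>bd\<close> by
  \<open>0c\<close>; the long one, in the primed lemmas, begins with \<open>bd\<close> to
  \<open>ac\<close> and continues with \<open>ad\<close> to \<open>0c\<close> and \<open>ac\<close>
  to \<open>0b\<close>.\<close>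

lemma pentagon_first: "down_quad n T 0 a b d"
  using down_quadD[OF Q] root by (auto simp: down_quad_def)

lemma pentagon_second: "down_quad n (down_flip 0 a b d T) 0 b c d"
  using down_quadD[OF Q] root by (auto simp: down_quad_def edge_down_flip[OF T pentagon_first])

lemma pentagon_first': "down_quad n (down_flip a b c d T) 0 a c d"
  using down_quadD[OF Q] root by (auto simp: down_quad_def edge_down_flip[OF T Q])

lemma pentagon_second': "down_quad n (down_flip 0 a c d (down_flip a b c d T)) 0 a b c"
  using down_quadD[OF Q] root
  by (auto simp: down_quad_def edge_down_flip[OF T Q]
      edge_down_flip[OF down_flip_triangulation[OF T Q] pentagon_first'])

lemma pentagon_closes:
  "down_flip 0 a b c (down_flip 0 a c d (down_flip a b c d T)) =
   down_flip 0 b c d (down_flip 0 a b d T)"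
proof -
  have "(0, b) \<notin> T" "(0, c) \<notin> T" "(a, c) \<notin> T"
    using edge_noncrossing[OF T, of 0 b a d] edge_noncrossing[OF T, of 0 c a d]
      quad_diagonals[OF T Q] down_quadD[OF Q] root by (auto simp: edge_def)
  then show ?thesis
    using down_quadD(1-3)[OF Q] root(1) by (auto simp: down_flip_def)
qed

end

text \<open>Both \<open>0q\<close> and \<open>0s\<close> are edges, whereas \<open>0c\<close> is not
  one because it crosses \<open>bd\<close>. So neither end point of \<open>qs\<close> can be c or 0,
  which leaves only \<open>bd\<close>.\<close>

lemma zero_quads_disjoint:
  assumes T: "T \<in> triangulations n" and Q: "down_quad n T 0 b c d" and P: "down_quad n T 0 q r s"
    and ne: "(b, d) \<noteq> (q, s)"
  shows "(q, s) \<notin> quad_edges 0 b c d"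
proof -
  note Q' = down_quadD[OF Q] and P' = down_quadD[OF P]
  have "\<not> edge n T 0 c" using not_edge_diagonal[OF T Q] .
  then show ?thesis using P' ne by (auto simp: quad_edges_def)
qed

section \<open>Triangulations in which the allowed down flips are exhausted\<close>

definition fan :: "nat \<Rightarrow> (nat \<times> nat) set" where
  "fan n = {(0, i) |i. 2 \<le> i \<and> i \<le> n + 1}"

text \<open>Descend from the root side. If \<open>0m\<close> is an edge with apex z, then z = m - 1:
  otherwise the apex u below \<open>zm\<close> would give a down flip in \<open>0zum\<close>. Thus
  every vertex is joined to 0.\<close>

lemma zero_terminal_is_fan:
  assumes T: "T \<in> triangulations n" and terminal: "\<And>b c d. \<not> down_quad n T 0 b c d"
  shows "T = fan n"
proof -
  have e: "edge n T 0 (n + 2 - k)" if "k \<le> n + 1" for k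
    using that
  proof (induction k)
    case 0
    then show ?case by (simp add: edge_def)
  next
    case (Suc k)
    then have k: "edge n T 0 (n + 2 - k)" "Suc 0 < n + 2 - k" by auto
    obtain z where z: "0 < z" "z < n + 2 - k" "edge n T 0 z" "edge n T z (n + 2 - k)"
      using apex_exists[OF T k] .
    have "Suc z = n + 2 - k"
    proof (rule ccontr)
      assume "Suc z \<noteq> n + 2 - k"
      then obtain u where "z < u" "u < n + 2 - k" "edge n T z u" "edge n T u (n + 2 - k)"
        using apex_exists[OF T z(4)] z(2) by auto
      then show False using terminal[of z u "n + 2 - k"] z k by (simp add: down_quad_def)
    qed
    then show ?case using z(3) by (metis Suc_diff_Suc Suc_inject add_diff_cancel_right' diff_Suc_eq_diff_pred diff_diff_left Suc_eq_plus1 diff_add_inverse2 plus_1_eq_Suc)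
  qed
  have e: "edge n T 0 i" if "1 \<le> i" "i \<le> n + 2" for i
    using e[of "n + 2 - i"] that by simp
  show ?thesis
  proof (intro subset_antisym subsetI)
    fix s assume s: "s \<in> T"
    obtain i j where ij: "s = (i, j)" by (cases s)
    note b = in_triangulation[OF T, of i j]
    have ij': "edge n T i j" using s ij by (simp add: edge_def)
    have "i = 0"
      using edge_noncrossing[OF T e[of "Suc i"] ij'] b s ij by auto
    then show "s \<in> fan n" using b s ij by (auto simp: fan_def)
  next
    fix s assume "s \<in> fan n"
    then obtain i where "s = (0, i)" "2 \<le> i" "i \<le> n + 1" by (auto simp: fan_def)
    then show "s \<in> T" using e[of i] by (auto simp: edge_def)
  qed
qed

text \<open>Each edge other than the root side belongs to a triangle below a longer edge. Starting
  at the root side, which every triangulation has, the hypothesis transfers all edges of T to U;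
  maximality turns the inclusion into equality.\<close>

lemma triangulation_eqI:
  assumes T: "T \<in> triangulations n" and U: "U \<in> triangulations n"
    and down: "\<And>x y z. \<lbrakk>edge n T x z; edge n T z y; edge n T x y; edge n U x y\<rbrakk> \<Longrightarrow> edge n U x z \<and> edge n U z y"
  shows "T = U"
proof -
  have "edge n U i j" if "edge n T i j" for i j
    using that
  proof (induction "n + 2 - (j - i)" arbitrary: i j rule: less_induct)
    case less
    note ij = edge_bounds[OF T less.prems]
    show ?case
    proof (cases "(i, j) = (0, n + 2)")
      case True
      then show ?thesis by (simp add: edge_def)
    next
      case False
      show ?thesis
      proof (rule parent_exists[OF T less.prems False])
        fix x assume x: "x < i" "edge n T x i" "edge n T x j"
        then have "edge n U x j" using less.hyps[of j x] ij by auto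
        then show ?thesis using down[OF x(2) less.prems x(3)] by blast
      next
        fix x assume x: "j < x" "edge n T i x" "edge n T j x"
        then have "edge n U i x" using less.hyps[of x i] ij edge_bounds[OF T x(2)] by auto
        then show ?thesis using down[OF less.prems x(3,2)] by blast
      qed
    qed
  qed
  then have "T \<subseteq> U"
    using in_triangulation[OF T] by (fastforce simp: edge_def)
  then show ?thesis
    using T U by (auto simp: maximal_simplices_def)
qed

text \<open>If the apex z below \<open>xy\<close> is not y - 1, let u be the apex below
  \<open>zy\<close>. Then \<open>xzuy\<close> admits a down flip, so \<open>zy\<close> is an edge of
  \<open>abcd\<close> by terminality. Away from the two triangles of \<open>abcd\<close> itself only
  \<open>zy = ad\<close> remains. The formula depends on a, b, c, d alone, whence
  uniqueness.\<close>

lemma terminal_apex: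
  assumes T: "T \<in> triangulations n" and Q: "down_quad n T a b c d"
    and terminal: "\<And>p q r s. down_quad n T p q r s \<Longrightarrow> (q, s) \<in> quad_edges a b c d"
    and xyz: "edge n T x z" "edge n T z y" "edge n T x y"
  shows "z = (if (x, y) = (a, d) then b else if (x, y) = (b, d) then c
              else if y = d \<and> x < a then a else y - 1)"
proof -
  note Q' = down_quadD[OF Q]
  note lt = edge_bounds(1)[OF T xyz(1)] edge_bounds(1)[OF T xyz(2)]
  consider "(x, y) = (a, d)" | "(x, y) = (b, d)" | "(x, y) \<noteq> (a, d)" "(x, y) \<noteq> (b, d)" by blast
  then show ?thesis
  proof cases
    case 1
    then show ?thesis using apex_unique[OF T Q'(4,8), of z] xyz by auto
  next
    case 2
    then show ?thesis using apex_unique[OF T Q'(5,6), of z] xyz Q'(1) by auto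
  next
    case 3
    show ?thesis
    proof (cases "Suc z = y")
      case True
      then have "\<not> (y = d \<and> x < a)"
        using edge_noncrossing[OF T xyz(1) Q'(7)] Q'(1-3) by auto
      then show ?thesis using 3 True by auto
    next
      case False
      then obtain u where u: "z < u" "u < y" "edge n T z u" "edge n T u y"
        using apex_exists[OF T xyz(2)] lt by auto
      then have "(z, y) \<in> quad_edges a b c d"
        using lt xyz by (intro terminal[of x z u y]) (simp add: down_quad_def)
      moreover have "(z, y) \<noteq> (a, b)"
        using edge_noncrossing[OF T xyz(3) Q'(7)] lt Q'(1-3) by auto
      moreover have "(z, y) \<noteq> (b, c)"
        using edge_noncrossing[OF T xyz(3) Q'(8)] lt Q'(1-3) by auto
      moreover have "(z, y) \<noteq> (c, d)"
      proof
        assume h: "(z, y) = (c, d)"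
        then have "x < b \<or> b < x" using 3 by auto
        then show False
          using edge_noncrossing[OF T xyz(1) Q'(8)] edge_noncrossing[OF T Q'(5) xyz(3)] h lt Q'(1-3) by auto
      qed
      moreover have "(z, y) \<noteq> (b, d)"
      proof
        assume h: "(z, y) = (b, d)"
        then have "x < a \<or> a < x" using 3 by auto
        then show False
          using edge_noncrossing[OF T xyz(1) Q'(7)] edge_noncrossing[OF T Q'(4) xyz(3)] h lt Q'(1-3) by auto
      qed
      ultimately have "z = a" "y = d" by (auto simp: quad_edges_def)
      then show ?thesis using 3 lt by auto
    qed
  qed
qed

lemma terminal_unique:
  assumes T: "T \<in> triangulations n" "down_quad n T a b c d"
    "\<And>p q r s. down_quad n T p q r s \<Longrightarrow> (q, s) \<in> quad_edges a b c d"
  and U: "U \<in> triangulations n" "down_quad n U a b c d"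
    "\<And>p q r s. down_quad n U p q r s \<Longrightarrow> (q, s) \<in> quad_edges a b c d"
  shows "T = U"
proof (rule triangulation_eqI[OF T(1) U(1)])
  fix x y z assume h: "edge n T x z" "edge n T z y" "edge n T x y" "edge n U x y"
  have "Suc x < y" using edge_bounds(1)[OF T(1) h(1)] edge_bounds(1)[OF T(1) h(2)] by simp
  then obtain z' where z': "edge n U x z'" "edge n U z' y"
    using apex_exists[OF U(1) h(4)] by blast
  have "z = z'"
    using terminal_apex[OF T h(1-3)] terminal_apex[OF U z' h(4)] by simp
  then show "edge n U x z \<and> edge n U z y" using z' by simp
qed

text \<open>Let \<open>0y\<close> be the shortest edge from 0 reaching d or beyond. Its apex z
  satisfies z \<le> a, as \<open>0z\<close> does not cross \<open>ad\<close>. If \<open>zy\<close>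
  differs from \<open>ad\<close>, the apex below \<open>zy\<close> yields a down flip at 0 whose
  removed diagonal is not an edge of \<open>abcd\<close>.\<close>

lemma root_triangle:
  assumes T: "T \<in> triangulations n" and Q: "down_quad n T a b c d" and "0 < a"
    and terminal: "\<And>q r s. down_quad n T 0 q r s \<Longrightarrow> (q, s) \<in> quad_edges a b c d"
  shows "edge n T 0 a" "edge n T 0 d"
proof -
  note Q' = down_quadD[OF Q]
  let ?P = "\<lambda>y. edge n T 0 y \<and> d \<le> y"
  define y where "y = (LEAST y. ?P y)"
  have "?P (n + 2)" using edge_bounds(2)[OF T Q'(7)] by (simp add: edge_def)
  then have y: "edge n T 0 y" "d \<le> y" and least: "\<And>x. \<lbrakk>edge n T 0 x; d \<le> x\<rbrakk> \<Longrightarrow> y \<le> x"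
    using LeastI[of ?P "n + 2"] Least_le[of ?P] by (auto simp: y_def)
  obtain z where z: "0 < z" "z < y" "edge n T 0 z" "edge n T z y"
    using apex_exists[OF T y(1)] y(2) Q'(1-3) by (metis Suc_lessI assms(3) less_le_trans less_trans not_less_eq)
  have "z < d" using least[OF z(3)] z(2) by linarith
  then have za: "z \<le> a" using edge_noncrossing[OF T z(3) Q'(7)] \<open>0 < a\<close> by simp
  have "(z, y) = (a, d)"
  proof (rule ccontr)
    assume ne: "(z, y) \<noteq> (a, d)"
    have "Suc z < y" using za y(2) Q'(1-3) by linarith
    then obtain u where u: "z < u" "u < y" "edge n T z u" "edge n T u y"
      using apex_exists[OF T z(4)] by blast
    have "(z, y) \<in> quad_edges a b c d"
      using u y z by (intro terminal[of z u y]) (simp add: down_quad_def)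
    then show False using ne za y(2) Q'(1-3) by (auto simp: quad_edges_def)
  qed
  then show "edge n T 0 a" "edge n T 0 d" using y z by auto
qed

text \<open>Two of the flips at 0 around the pentagon \<open>0abcd\<close> remove \<open>ad\<close>;
  this makes them disjoint from \<open>pqrs\<close>. A quadrilateral directly below
  \<open>ad\<close> would contain the triangle \<open>abd\<close>, and one above \<open>ad\<close>
  would have an edge crossing \<open>0a\<close> or \<open>0d\<close>.\<close>

lemma root_side_not_in_quad:
  assumes T: "T \<in> triangulations n" and Q: "down_quad n T a b c d" and P: "down_quad n T p q r s"
    and root: "0 < a" "edge n T 0 a" "edge n T 0 d" and "0 < p"
    and disj: "(q, s) \<notin> quad_edges a b c d"
  shows "(a, d) \<notin> quad_edges p q r s"
proof
  assume h: "(a, d) \<in> quad_edges p q r s"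
  note Q' = down_quadD[OF Q] and P' = down_quadD[OF P]
  note ne = disj[unfolded quad_edges_def, simplified]
  have "(a, d) \<noteq> (p, s)"
    using apex_unique[OF T Q'(4,8), of q] P' ne by auto
  moreover have "(a, d) \<noteq> (p, q)" "(a, d) \<noteq> (q, r)"
    using edge_noncrossing[OF T root(3), of a s] P' Q'(1-3) root by auto
  moreover have "(a, d) \<noteq> (r, s)"
    using edge_noncrossing[OF T root(2) P'(8)] P'(1-3) \<open>0 < p\<close> by auto
  ultimately show False using h ne by (auto simp: quad_edges_def)
qed

section \<open>Signed flip counts\<close>

text \<open>Adding the corner 0 turns these into the pentagons through vertex 0, whose boundary
  loops map to the basis.\<close>

definition rootless_quads :: "nat \<Rightarrow> (nat \<times> nat \<times> nat \<times> nat) set" where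
  "rootless_quads n = {(a, b, c, d). 0 < a \<and> a < b \<and> b < c \<and> c < d \<and> d \<le> n + 2}"

lemma finite_rootless_quads: "finite (rootless_quads n)"
  by (rule finite_subset[of _ "{..n+2} \<times> {..n+2} \<times> {..n+2} \<times> {..n+2}"]) (auto simp: rootless_quads_def)

lemma card_rootless_quads: "card (rootless_quads n) = (n + 2) choose 4"
proof -
  let ?f = "\<lambda>(a, b, c, d). {a, b, c, d} :: nat set"
  have "bij_betw ?f (rootless_quads n) {S. S \<subseteq> {1..n + 2} \<and> card S = 4}"
    unfolding bij_betw_def
  proof (intro conjI inj_onI)
    fix x y assume xy: "x \<in> rootless_quads n" "y \<in> rootless_quads n" "?f x = ?f y"
    obtain a b c d where x: "x = (a, b, c, d)" by (cases x)
    obtain a' b' c' d' where y: "y = (a', b', c', d')" by (cases y)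
    have "[a, b, c, d] = [a', b', c', d']"
      by (rule strict_sorted_equal) (use xy x y in \<open>simp_all add: rootless_quads_def\<close>)
    then show "x = y" using x y by simp
  next
    show "?f ` rootless_quads n = {S. S \<subseteq> {1..n + 2} \<and> card S = 4}"
    proof (intro subset_antisym subsetI)
      fix S assume "S \<in> ?f ` rootless_quads n"
      then obtain a b c d where "S = {a, b, c, d}" "0 < a" "a < b" "b < c" "c < d" "d \<le> n + 2"
        by (auto simp: rootless_quads_def)
      then show "S \<in> {S. S \<subseteq> {1..n + 2} \<and> card S = 4}"
        by simp
    next
      fix S assume S: "S \<in> {S. S \<subseteq> {1..n + 2} \<and> card S = 4}"
      then have fin: "finite S" using finite_subset by blast
      define l where "l = sorted_list_of_set S"
      have l: "length l = 4" "sorted_wrt (<) l" "set l = S"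
        using S fin by (auto simp: l_def)
      obtain a b c d where abcd: "l = [a, b, c, d]"
        using l(1) by (auto simp: numeral_eq_Suc length_Suc_conv)
      have "S = {a, b, c, d}" "a < b" "b < c" "c < d"
        using l(2,3) unfolding abcd by simp_all
      moreover from this have "0 < a" "d \<le> n + 2" using S by simp_all
      ultimately have "S = ?f (a, b, c, d)" "(a, b, c, d) \<in> rootless_quads n"
        by (simp_all add: rootless_quads_def)
      then show "S \<in> ?f ` rootless_quads n" by blast
    qed
  qed
  then have "card (rootless_quads n) = card {S. S \<subseteq> {1..n + 2} \<and> card S = 4}"
    by (rule bij_betw_same_card)
  then show ?thesis by (simp add: n_subsets)
qed

lemma quad_exists:
  assumes "0 < a" "a < b" "b < c" "c < d" "d \<le> n + 2"
  obtains T where "T \<in> triangulations n" "down_quad n T a b c d" "edge n T 0 a" "edge n T 0 d"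
proof -
  define S where "S = {(0, a), (a, b), (b, c), (c, d), (0, d), (a, d), (b, d)}"
  have nc: "\<forall>e\<in>S. \<forall>f\<in>S. \<not> crossing e f"
    using assms by (simp add: S_def)
  \<comment> \<open>Some members of S may be sides of the polygon, which are not vertices of the
    complex but are edges in any case.\<close>
  have "S \<inter> diagonals (n + 3) \<in> noncrossing_complex n"
    using nc unfolding noncrossing_complex_def by blast
  then obtain T where T: "T \<in> triangulations n" "S \<inter> diagonals (n + 3) \<subseteq> T"
    by (rule triangulation_extending)
  have "edge n T i j" if "(i, j) \<in> S" for i j
  proof (cases "(i, j) \<in> diagonals (n + 3)")
    case True
    then show ?thesis using T that by (auto simp: edge_def)
  next
    case False
    moreover have "i < j" "j \<le> n + 2" using that assms by (auto simp: S_def)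
    ultimately show ?thesis by (auto simp: edge_def diagonals_def)
  qed
  then have "down_quad n T a b c d" "edge n T 0 a" "edge n T 0 d"
    using assms by (auto simp: down_quad_def S_def)
  then show ?thesis using that T by blast
qed

text \<open>Only the two set differences enter, so parallel sides of a square of commuting flips
  have equal weight at once.\<close>

definition flip_weight :: "(nat \<times> nat) set \<Rightarrow> (nat \<times> nat) set \<Rightarrow> nat \<times> nat \<times> nat \<times> nat \<Rightarrow> int" where
  "flip_weight x y = (\<lambda>(a, b, c, d). of_bool ((b, d) \<in> x - y \<and> (a, c) \<in> y - x)
      - of_bool ((a, c) \<in> x - y \<and> (b, d) \<in> y - x))"

fun walk_weight :: "(nat \<times> nat) set list \<Rightarrow> nat \<times> nat \<times> nat \<times> nat \<Rightarrow> int" where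
  "walk_weight (x # y # l) = (\<lambda>Q. flip_weight x y Q + walk_weight (y # l) Q)"
| "walk_weight _ = (\<lambda>Q. 0)"

lemma flip_weight_refl [simp]: "flip_weight x x = (\<lambda>Q. 0)"
  by (auto simp: flip_weight_def)

lemma flip_weight_swap: "flip_weight y x Q = - flip_weight x y Q"
  by (cases Q) (auto simp: flip_weight_def)

lemma flip_weight_down_flip:
  assumes "T \<in> triangulations n" "down_quad n T a b c d" "Q \<in> rootless_quads n"
  shows "flip_weight T (down_flip a b c d T) Q = of_bool (Q = (a, b, c, d))"
  using assms(3) down_quadD(1-3)[OF assms(2)]
  unfolding flip_weight_def down_flip_diffs[OF assms(1,2)]
  by (auto simp: rootless_quads_def of_bool_def split: if_splits)

lemma flip_weight_square:
  assumes "n \<ge> 2" "x \<in> triangulations n" "y \<in> triangulations n" "z \<in> triangulations n" "t \<in> triangulations n"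
    and "flip_near n x y" "flip_near n y z" "flip_near n x t" "flip_near n t z"
  shows "flip_weight x y Q + flip_weight y z Q = flip_weight x t Q + flip_weight t z Q"
proof -
  consider "x = z" | "y = t" | "x \<noteq> z" "y \<noteq> t" by blast
  then show ?thesis
  proof cases
    case 1
    then show ?thesis using flip_weight_swap[of x y Q] flip_weight_swap[of x t Q] by simp
  next
    case 3
    from flip_square[OF assms 3]
    have "flip_weight x y = flip_weight t z" "flip_weight y z = flip_weight x t"
      by (simp_all add: flip_weight_def)
    then show ?thesis by simp
  qed simp
qed

section \<open>Cocycles on the flip graph\<close>

text \<open>Squares may degenerate: with z and t both equal to x the last axiom makes the values on
  opposite directions inverse to each other, so this needs no separate axiom.\<close>

locale flip_cocycle = comm_group A for A (structure) +
  fixes n :: nat and \<gamma> :: "(nat \<times> nat) set \<Rightarrow> (nat \<times> nat) set \<Rightarrow> 'a"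
  assumes n: "n \<ge> 2"
    and cocycle_closed: "\<lbrakk>x \<in> triangulations n; y \<in> triangulations n; flip_near n x y\<rbrakk> \<Longrightarrow> \<gamma> x y \<in> carrier A"
    and cocycle_refl: "x \<in> triangulations n \<Longrightarrow> \<gamma> x x = \<one>"
    and cocycle_square: "\<lbrakk>x \<in> triangulations n; y \<in> triangulations n; z \<in> triangulations n; t \<in> triangulations n;
        flip_near n x y; flip_near n y z; flip_near n x t; flip_near n t z\<rbrakk>
        \<Longrightarrow> \<gamma> x y \<otimes> \<gamma> y z = \<gamma> x t \<otimes> \<gamma> t z"
begin

section \<open>The potential defined by flips at vertex 0\<close>

lemmas tri = down_flip_triangulation and near = near_down_flip[OF n]

text \<open>A relation at first, because the chain of flips from T to the fan is not unique;
  \<open>potential_unique\<close> makes it the function \<open>h\<close>.\<close>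

inductive potential :: "(nat \<times> nat) set \<Rightarrow> 'a \<Rightarrow> bool" where
  terminal: "(\<And>b c d. \<not> down_quad n T 0 b c d) \<Longrightarrow> potential T \<one>"
| step: "down_quad n T 0 b c d \<Longrightarrow> potential (down_flip 0 b c d T) v \<Longrightarrow>
     potential T (\<gamma> T (down_flip 0 b c d T) \<otimes> v)"

text \<open>Two distinct flips increasing the degree of vertex 0 take place in quadrilaterals with
  disjoint interiors, hence commute; so these flips form a confluent system.\<close>

lemma potential_unique:
  assumes "T \<in> triangulations n"
  shows "\<exists>v\<in>carrier A. \<forall>v'. potential T v' \<longleftrightarrow> v' = v"
  using assms
proof (induction "\<Sum>(i, j)\<in>T. i + j" arbitrary: T rule: less_induct)
  case less
  note T = less.prems
  have IH: "\<exists>v\<in>carrier A. \<forall>v'. potential (down_flip 0 b c d T) v' \<longleftrightarrow> v' = v"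
    if "down_quad n T 0 b c d" for b c d
    using less.hyps down_flip_measure[OF T that] tri[OF T that] by blast
  show ?case
  proof (cases "\<exists>b c d. down_quad n T 0 b c d")
    case False
    then have "potential T v' \<longleftrightarrow> v' = \<one>" for v'
      by (auto intro: terminal elim: potential.cases)
    then show ?thesis by blast
  next
    case True
    then obtain b c d where Q: "down_quad n T 0 b c d" by blast
    let ?U = "down_flip 0 b c d T"
    obtain v where v: "v \<in> carrier A" "\<And>v'. potential ?U v' \<longleftrightarrow> v' = v" using IH[OF Q] by blast
    have U: "?U \<in> triangulations n" and TU: "flip_near n T ?U" using tri near T Q by auto
    have cTU: "\<gamma> T ?U \<in> carrier A" by (rule cocycle_closed[OF T U TU])
    have "v' = \<gamma> T ?U \<otimes> v" if "potential T v'" for v'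
      using that
    proof cases
      case terminal
      then show ?thesis using Q by blast
    next
      case (step q r s v2)
      note P = step(2) and v2 = step(3)
      let ?V = "down_flip 0 q r s T"
      have V: "?V \<in> triangulations n" and TV: "flip_near n T ?V" using tri near T P by auto
      show ?thesis
      proof (cases "(b, d) = (q, s)")
        case True
        then have "c = r" using apex_unique[OF T, of b c d r] down_quadD[OF Q] down_quadD[OF P] by auto
        then show ?thesis using True step v by auto
      next
        case False
        have "(b, d) \<notin> quad_edges 0 q r s" "(q, s) \<notin> quad_edges 0 b c d"
          using zero_quads_disjoint[OF T P Q] zero_quads_disjoint[OF T Q P] False by auto
        then have PU: "down_quad n ?U 0 q r s" and QV: "down_quad n ?V 0 b c d"
          using down_quad_after_flip[OF T Q P] down_quad_after_flip[OF T P Q] by auto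
        \<comment> \<open>The common successor of both flips closes a square. By induction the
          potentials of both neighbours of T can be computed through it.\<close>
        let ?W = "down_flip 0 q r s ?U"
        have W: "?W = down_flip 0 b c d ?V" by (rule down_flips_commute[OF T Q P])
        have Wt: "?W \<in> triangulations n" and UW: "flip_near n ?U ?W" using tri near U PU by auto
        have VW: "flip_near n ?V ?W" unfolding W using near V QV by auto
        obtain w where w: "w \<in> carrier A" "\<And>v'. potential ?W v' \<longleftrightarrow> v' = w"
          using less.hyps[of ?W] down_flip_measure[OF T Q] down_flip_measure[OF U PU] Wt by auto
        obtain v3 where v3: "\<And>v'. potential ?V v' \<longleftrightarrow> v' = v3" using IH[OF P] by blast
        have "v = \<gamma> ?U ?W \<otimes> w"
          using potential.step[OF PU] w v by auto
        moreover have "v2 = \<gamma> ?V ?W \<otimes> w"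
          using potential.step[OF QV, of w] w v2 v3 W by auto
        moreover have "\<gamma> T ?U \<otimes> \<gamma> ?U ?W = \<gamma> T ?V \<otimes> \<gamma> ?V ?W"
          by (rule cocycle_square[OF T U Wt V TU UW TV VW])
        ultimately show ?thesis
          using step(1) w(1) cTU cocycle_closed[OF U Wt UW] cocycle_closed[OF T V TV] cocycle_closed[OF V Wt VW]
          by (simp add: m_assoc[symmetric])
      qed
    qed
    moreover have "potential T (\<gamma> T ?U \<otimes> v)" using potential.step[OF Q] v by blast
    ultimately show ?thesis using v cTU by blast
  qed
qed

definition h :: "(nat \<times> nat) set \<Rightarrow> 'a" where
  "h T = (THE v. potential T v)"

lemma potential_h: "T \<in> triangulations n \<Longrightarrow> potential T v \<longleftrightarrow> v = h T"
  unfolding h_def using potential_unique[of T] by (metis the_equality)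

lemma h_closed [simp]: "T \<in> triangulations n \<Longrightarrow> h T \<in> carrier A"
  using potential_unique[of T] potential_h[of T] by metis

lemma h_step:
  assumes "T \<in> triangulations n" "down_quad n T 0 b c d"
  shows "h T = \<gamma> T (down_flip 0 b c d T) \<otimes> h (down_flip 0 b c d T)"
  using potential.step[OF assms(2)] potential_h[OF assms(1)] potential_h[OF tri[OF assms]] by metis

text \<open>The cocycle changed by the coboundary of \<open>h\<close>. The recursion for
  \<open>h\<close> makes it trivial on the down flips at 0.\<close>

definition \<delta> :: "(nat \<times> nat) set \<Rightarrow> (nat \<times> nat) set \<Rightarrow> 'a" where
  "\<delta> x y = inv (h x) \<otimes> \<gamma> x y \<otimes> h y"

lemma \<delta>_closed: "\<lbrakk>x \<in> triangulations n; y \<in> triangulations n; flip_near n x y\<rbrakk> \<Longrightarrow> \<delta> x y \<in> carrier A"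
  by (simp add: \<delta>_def cocycle_closed)

lemma \<delta>_compose:
  assumes "x \<in> triangulations n" "y \<in> triangulations n" "z \<in> triangulations n" "flip_near n x y" "flip_near n y z"
  shows "\<delta> x y \<otimes> \<delta> y z = inv (h x) \<otimes> (\<gamma> x y \<otimes> \<gamma> y z) \<otimes> h z"
proof -
  have c: "\<gamma> x y \<in> carrier A" "\<gamma> y z \<in> carrier A" using assms cocycle_closed by auto
  have "h y \<otimes> (inv (h y) \<otimes> (\<gamma> y z \<otimes> h z)) = \<gamma> y z \<otimes> h z"
    using assms c by (simp add: m_assoc[symmetric])
  then show ?thesis using assms c by (simp add: \<delta>_def m_assoc)
qed

lemma \<delta>_refl: "x \<in> triangulations n \<Longrightarrow> \<delta> x x = \<one>"
  by (simp add: \<delta>_def cocycle_refl)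

lemma \<delta>_square:
  assumes "x \<in> triangulations n" "y \<in> triangulations n" "z \<in> triangulations n" "t \<in> triangulations n"
    "flip_near n x y" "flip_near n y z" "flip_near n x t" "flip_near n t z"
  shows "\<delta> x y \<otimes> \<delta> y z = \<delta> x t \<otimes> \<delta> t z"
  using assms cocycle_square[OF assms] by (simp add: \<delta>_compose)

lemma \<delta>_inverse:
  assumes "x \<in> triangulations n" "y \<in> triangulations n" "flip_near n x y"
  shows "\<delta> x y \<otimes> \<delta> y x = \<one>"
  using \<delta>_square[OF assms(1,2,1,1,3) q_near_sym[OF assms(3)]] assms(1) flip_near_refl[OF n assms(1)]
  by (simp add: \<delta>_refl)

section \<open>The value of a flip depends only on its quadrilateral\<close>

abbreviation flip_value :: "(nat \<times> nat) set \<Rightarrow> nat \<Rightarrow> nat \<Rightarrow> nat \<Rightarrow> nat \<Rightarrow> 'a" where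
  "flip_value T a b c d \<equiv> \<delta> T (down_flip a b c d T)"

lemma flip_value_closed:
  "\<lbrakk>T \<in> triangulations n; down_quad n T a b c d\<rbrakk> \<Longrightarrow> flip_value T a b c d \<in> carrier A"
  by (simp add: \<delta>_closed tri near)

lemma zero_flip_value:
  assumes "T \<in> triangulations n" "down_quad n T 0 b c d"
  shows "flip_value T 0 b c d = \<one>"
  using assms tri[OF assms] cocycle_closed[OF assms(1) tri[OF assms] near[OF assms]]
  by (simp add: \<delta>_def m_assoc h_step[OF assms, symmetric])

lemma commuting_flip_values:
  assumes T: "T \<in> triangulations n" and Q: "down_quad n T a b c d" and P: "down_quad n T p q r s"
    and disj: "(q, s) \<notin> quad_edges a b c d"
  shows "flip_value T a b c d \<otimes> flip_value (down_flip a b c d T) p q r s =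
    flip_value T p q r s \<otimes> flip_value (down_flip p q r s T) a b c d"
proof -
  have P': "down_quad n (down_flip a b c d T) p q r s"
    by (rule down_quad_after_flip[OF T Q P quad_edges_sym[OF T Q P disj]])
  have Q': "down_quad n (down_flip p q r s T) a b c d"
    by (rule down_quad_after_flip[OF T P Q disj])
  note U = tri[OF T Q] and V = tri[OF T P]
  show ?thesis
    using \<delta>_square[OF T U tri[OF U P'] V near[OF T Q] near[OF U P'] near[OF T P]]
      near[OF V Q'] down_flips_commute[OF T Q P] by simp
qed

text \<open>In the square of the two flips, both sides belonging to the flip at 0 are trivial, so
  the other two sides agree.\<close>

lemma flip_value_zero_flip:
  assumes T: "T \<in> triangulations n" and Q: "down_quad n T a b c d" and P: "down_quad n T 0 q r s"
    and disj: "(q, s) \<notin> quad_edges a b c d"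
  shows "flip_value T a b c d = flip_value (down_flip 0 q r s T) a b c d"
proof -
  have P': "down_quad n (down_flip a b c d T) 0 q r s"
    by (rule down_quad_after_flip[OF T Q P quad_edges_sym[OF T Q P disj]])
  have Q': "down_quad n (down_flip 0 q r s T) a b c d"
    by (rule down_quad_after_flip[OF T P Q disj])
  show ?thesis
    using commuting_flip_values[OF T Q P disj] zero_flip_value[OF T P] zero_flip_value[OF tri[OF T Q] P']
      flip_value_closed[OF T Q] flip_value_closed[OF tri[OF T P] Q'] by simp
qed

text \<open>The flip in \<open>abcd\<close> is one side of the pentagon \<open>0abcd\<close> whose other four sides are flips
  at vertex 0, all of them disjoint from \<open>pqrs\<close>.\<close>

lemma flip_value_across_pentagon:
  assumes T: "T \<in> triangulations n" and Q: "down_quad n T a b c d" and P: "down_quad n T p q r s"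
    and root: "0 < a" "edge n T 0 a" "edge n T 0 d" and "0 < p"
    and disj: "(q, s) \<notin> quad_edges a b c d"
  shows "flip_value T p q r s = flip_value (down_flip a b c d T) p q r s"
proof -
  have ad: "(a, d) \<notin> quad_edges p q r s"
    by (rule root_side_not_in_quad[OF T Q P root \<open>0 < p\<close> disj])
  have bd: "(b, d) \<notin> quad_edges p q r s"
    by (rule quad_edges_sym[OF T Q P disj])
  have ac: "(a, c) \<notin> quad_edges p q r s"
    using not_edge_diagonal[OF T Q] down_quadD[OF P] by (auto simp: quad_edges_def)
  note Z1 = pentagon_first[OF T Q root] and Z2 = pentagon_second[OF T Q root]
    and Y1 = pentagon_first'[OF T Q root] and Y2 = pentagon_second'[OF T Q root]
  let ?T1 = "down_flip 0 a b d T" and ?U = "down_flip a b c d T"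
  let ?U1 = "down_flip 0 a c d ?U"
  have T1: "?T1 \<in> triangulations n" by (rule tri[OF T Z1])
  have U: "?U \<in> triangulations n" by (rule tri[OF T Q])
  have U1: "?U1 \<in> triangulations n" by (rule tri[OF U Y1])
  have P1: "down_quad n ?T1 p q r s" by (rule down_quad_after_flip[OF T Z1 P ad])
  have PU: "down_quad n ?U p q r s" by (rule down_quad_after_flip[OF T Q P bd])
  have PU1: "down_quad n ?U1 p q r s" by (rule down_quad_after_flip[OF U Y1 PU ad])
  show ?thesis
    using flip_value_zero_flip[OF T P Z1 ad] flip_value_zero_flip[OF T1 P1 Z2 bd]
      flip_value_zero_flip[OF U PU Y1 ad] flip_value_zero_flip[OF U1 PU1 Y2 ac]
      pentagon_closes[OF T Q root] by simp
qed

text \<open>The two sides of the square belonging to \<open>pqrs\<close> agree by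
  \<open>flip_value_across_pentagon\<close>. Cancelling them, which uses that A is commutative,
  equates the sides belonging to \<open>abcd\<close>.\<close>

lemma flip_value_disjoint_flip:
  assumes T: "T \<in> triangulations n" and Q: "down_quad n T a b c d" and P: "down_quad n T p q r s"
    and root: "0 < a" "edge n T 0 a" "edge n T 0 d" and "0 < p"
    and disj: "(q, s) \<notin> quad_edges a b c d"
  shows "flip_value T a b c d = flip_value (down_flip p q r s T) a b c d"
proof -
  have Q': "down_quad n (down_flip p q r s T) a b c d"
    by (rule down_quad_after_flip[OF T P Q disj])
  show ?thesis
    using commuting_flip_values[OF T Q P disj] flip_value_across_pentagon[OF assms, symmetric]
      flip_value_closed[OF T Q] flip_value_closed[OF T P] flip_value_closed[OF tri[OF T P] Q']
    by (simp add: m_comm[of "flip_value T a b c d"])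
qed

text \<open>Disjoint flips at 0 are preferred. Once there are none, \<open>root_triangle\<close>
  supplies the triangle \<open>0ad\<close>, and the remaining disjoint flips may be used.\<close>

lemma flip_value_terminal:
  assumes "T \<in> triangulations n" "down_quad n T a b c d" "0 < a"
  shows "\<exists>N\<in>triangulations n. down_quad n N a b c d \<and>
     (\<forall>p q r s. down_quad n N p q r s \<longrightarrow> (q, s) \<in> quad_edges a b c d) \<and>
     flip_value T a b c d = flip_value N a b c d"
  using assms
proof (induction "\<Sum>(i, j)\<in>T. i + j" arbitrary: T rule: less_induct)
  case less
  note T = less.prems(1) and Q = less.prems(2)
  have step: ?case if P: "down_quad n T p q r s" and disj: "(q, s) \<notin> quad_edges a b c d"
    and eq: "flip_value T a b c d = flip_value (down_flip p q r s T) a b c d" for p q r s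
    unfolding eq using less.hyps[OF down_flip_measure[OF T P] tri[OF T P]
        down_quad_after_flip[OF T P Q disj] \<open>0 < a\<close>] .
  consider q r s where "down_quad n T 0 q r s" "(q, s) \<notin> quad_edges a b c d"
    | p q r s where "down_quad n T p q r s" "(q, s) \<notin> quad_edges a b c d"
      "\<And>q r s. down_quad n T 0 q r s \<Longrightarrow> (q, s) \<in> quad_edges a b c d"
    | "\<And>p q r s. down_quad n T p q r s \<Longrightarrow> (q, s) \<in> quad_edges a b c d"
    by blast
  then show ?case
  proof cases
    case 1
    then show ?thesis using step flip_value_zero_flip[OF T Q] by blast
  next
    case 2
    have root: "0 < a" "edge n T 0 a" "edge n T 0 d"
      by (rule \<open>0 < a\<close>, (rule root_triangle[OF T Q \<open>0 < a\<close>], erule 2(3))+)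
    \<comment> \<open>With p = 0 this would be a disjoint flip at 0, and in this case there are none
      left.\<close>
    have "0 < p" using 2 by (cases p) auto
    then show ?thesis using step[OF 2(1,2)] flip_value_disjoint_flip[OF T Q 2(1) root _ 2(2)] by blast
  next
    case 3
    then show ?thesis using T Q by blast
  qed
qed

lemma flip_value_independent:
  assumes "T \<in> triangulations n" "down_quad n T a b c d" "U \<in> triangulations n" "down_quad n U a b c d" "0 < a"
  shows "flip_value T a b c d = flip_value U a b c d"
proof -
  obtain N where N: "N \<in> triangulations n" "down_quad n N a b c d"
    "\<And>p q r s. down_quad n N p q r s \<Longrightarrow> (q, s) \<in> quad_edges a b c d"
    "flip_value T a b c d = flip_value N a b c d"
    using flip_value_terminal[OF assms(1,2,5)] by blast
  obtain M where M: "M \<in> triangulations n" "down_quad n M a b c d"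
    "\<And>p q r s. down_quad n M p q r s \<Longrightarrow> (q, s) \<in> quad_edges a b c d"
    "flip_value U a b c d = flip_value M a b c d"
    using flip_value_terminal[OF assms(3,4,5)] by blast
  have "N = M"
    by (rule terminal_unique[OF N(1,2) _ M(1,2)]; erule N(3) M(3))
  then show ?thesis using N(4) M(4) by simp
qed

section \<open>Evaluation of integer weights on quadrilaterals\<close>

definition quad_value :: "nat \<times> nat \<times> nat \<times> nat \<Rightarrow> 'a" where
  "quad_value = (\<lambda>(a, b, c, d). flip_value (SOME T. T \<in> triangulations n \<and> down_quad n T a b c d) a b c d)"

lemma quad_value_eq:
  assumes "T \<in> triangulations n" "down_quad n T a b c d" "0 < a"
  shows "quad_value (a, b, c, d) = flip_value T a b c d"
proof -
  let ?U = "SOME T. T \<in> triangulations n \<and> down_quad n T a b c d"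
  have "?U \<in> triangulations n \<and> down_quad n ?U a b c d"
    by (rule someI[of _ T]) (use assms in auto)
  then show ?thesis using flip_value_independent[OF _ _ assms] by (simp add: quad_value_def)
qed

lemma quad_value_closed: "Q \<in> rootless_quads n \<Longrightarrow> quad_value Q \<in> carrier A"
proof -
  assume "Q \<in> rootless_quads n"
  then obtain a b c d where Q: "Q = (a, b, c, d)" "0 < a" "a < b" "b < c" "c < d" "d \<le> n + 2"
    by (auto simp: rootless_quads_def)
  obtain T where "T \<in> triangulations n" "down_quad n T a b c d"
    using quad_exists[OF Q(2-)] by blast
  then show ?thesis using Q quad_value_eq flip_value_closed by metis
qed

text \<open>The homomorphism out of the free abelian group on the quadrilaterals that is determined
  by \<open>quad_value\<close>, written on coefficient functions.\<close>

definition evaluate :: "(nat \<times> nat \<times> nat \<times> nat \<Rightarrow> int) \<Rightarrow> 'a" where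
  "evaluate f = (\<Otimes>Q\<in>rootless_quads n. quad_value Q [^] f Q)"

lemma evaluate_closed: "evaluate f \<in> carrier A"
  unfolding evaluate_def by (intro finprod_closed) (auto simp: quad_value_closed)

lemma evaluate_zero: "(\<And>Q. Q \<in> rootless_quads n \<Longrightarrow> f Q = 0) \<Longrightarrow> evaluate f = \<one>"
  unfolding evaluate_def by (intro finprod_one_eqI) auto

lemma evaluate_add: "evaluate (\<lambda>Q. f Q + g Q) = evaluate f \<otimes> evaluate g"
proof -
  have "evaluate (\<lambda>Q. f Q + g Q) = (\<Otimes>Q\<in>rootless_quads n. quad_value Q [^] f Q \<otimes> quad_value Q [^] g Q)"
    unfolding evaluate_def by (intro finprod_cong') (auto simp: quad_value_closed int_pow_mult)
  then show ?thesis
    unfolding evaluate_def by (simp add: finprod_multf quad_value_closed Pi_def)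
qed

lemma evaluate_down_flip:
  assumes T: "T \<in> triangulations n" and Q: "down_quad n T a b c d"
  shows "flip_value T a b c d = evaluate (flip_weight T (down_flip a b c d T))"
proof (cases "a = 0")
  case True
  then have "flip_weight T (down_flip a b c d T) R = 0" if "R \<in> rootless_quads n" for R
    using flip_weight_down_flip[OF T Q that] that by (auto simp: rootless_quads_def)
  then show ?thesis using True zero_flip_value[OF T] Q by (simp add: evaluate_zero)
next
  case False
  then have mem: "(a, b, c, d) \<in> rootless_quads n"
    using down_quadD(1-3)[OF Q] quad_bound[OF T Q] by (simp add: rootless_quads_def)
  have "evaluate (flip_weight T (down_flip a b c d T)) =
    (\<Otimes>R\<in>rootless_quads n. if (a, b, c, d) = R then quad_value R else \<one>)"
    unfolding evaluate_def
    by (intro finprod_cong') (auto simp: quad_value_closed flip_weight_down_flip[OF T Q])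
  also have "\<dots> = quad_value (a, b, c, d)"
    by (rule finprod_singleton[OF mem finite_rootless_quads]) (auto simp: quad_value_closed)
  finally show ?thesis using quad_value_eq[OF T Q] False by simp
qed

lemma \<delta>_evaluate:
  assumes x: "x \<in> triangulations n" and y: "y \<in> triangulations n" and xy: "flip_near n x y"
  shows "\<delta> x y = evaluate (flip_weight x y)"
proof (rule near_cases[OF n x y xy])
  assume "x = y"
  then show ?thesis using x by (simp add: \<delta>_refl evaluate_zero)
next
  fix a b c d assume "down_quad n x a b c d" "y = down_flip a b c d x"
  then show ?thesis using evaluate_down_flip[OF x] by simp
next
  fix a b c d assume "down_quad n y a b c d" "x = down_flip a b c d y"
  then have yx: "\<delta> y x = evaluate (flip_weight y x)" using evaluate_down_flip[OF y] by simp
  have "evaluate (flip_weight x y) \<otimes> evaluate (flip_weight y x) = \<one>"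
    unfolding evaluate_add[symmetric] by (rule evaluate_zero) (simp add: flip_weight_swap[of y])
  moreover have "\<delta> x y \<otimes> \<delta> y x = \<one>" by (rule \<delta>_inverse[OF assms])
  ultimately show ?thesis
    unfolding yx using evaluate_closed \<delta>_closed[OF assms] inv_equality by metis
qed

section \<open>Products of the cocycle along walks\<close>

fun walk_product :: "(nat \<times> nat) set list \<Rightarrow> 'a" where
  "walk_product (x # y # l) = \<gamma> x y \<otimes> walk_product (y # l)"
| "walk_product _ = \<one>"

text \<open>The coboundary factors telescope, leaving those at the two ends; for a closed walk these
  cancel as well.\<close>

lemma walk_product_eq:
  assumes "l \<noteq> []" "set l \<subseteq> triangulations n" "successively (flip_near n) l"
  shows "walk_product l = h (hd l) \<otimes> evaluate (walk_weight l) \<otimes> inv (h (last l))"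
  using assms
proof (induction l rule: walk_product.induct)
  case (1 x y l)
  then have xy: "x \<in> triangulations n" "y \<in> triangulations n" "flip_near n x y" by auto
  have z: "last (y # l) \<in> triangulations n" using 1(3) last_in_set[of "y # l"] by auto
  have IH: "walk_product (y # l) = h y \<otimes> evaluate (walk_weight (y # l)) \<otimes> inv (h (last (y # l)))"
    using 1 by auto
  have "\<gamma> x y = h x \<otimes> \<delta> x y \<otimes> inv (h y)"
  proof -
    have g: "\<gamma> x y \<in> carrier A" using cocycle_closed xy by blast
    have "h x \<otimes> (inv (h x) \<otimes> \<gamma> x y) = \<gamma> x y"
      using xy g by (simp add: m_assoc[symmetric])
    then show ?thesis using xy g by (simp add: \<delta>_def m_assoc)
  qed
  moreover have "inv (h y) \<otimes> (h y \<otimes> (evaluate (walk_weight (y # l)) \<otimes> inv (h (last (y # l))))) =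
      evaluate (walk_weight (y # l)) \<otimes> inv (h (last (y # l)))"
    using xy z evaluate_closed by (simp add: m_assoc[symmetric])
  ultimately have "walk_product (x # y # l) =
      h x \<otimes> (\<delta> x y \<otimes> evaluate (walk_weight (y # l))) \<otimes> inv (h (last (y # l)))"
    using xy z evaluate_closed \<delta>_closed[OF xy] unfolding walk_product.simps IH
    by (simp add: m_assoc del: last.simps walk_weight.simps)
  also have "\<delta> x y \<otimes> evaluate (walk_weight (y # l)) = evaluate (walk_weight (x # y # l))"
    by (simp add: \<delta>_evaluate[OF xy] evaluate_add)
  finally show ?case by simp
qed (auto simp: evaluate_zero)

lemma closed_walk_product:
  assumes "l \<noteq> []" "set l \<subseteq> triangulations n" "successively (flip_near n) l" "hd l = last l"
    and "\<And>Q. Q \<in> rootless_quads n \<Longrightarrow> walk_weight l Q = 0"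
  shows "walk_product l = \<one>"
proof -
  have "last l \<in> triangulations n" using assms by auto
  then show ?thesis
    using walk_product_eq[OF assms(1-3)] evaluate_zero[OF assms(5)] assms(4) by simp
qed

end

section \<open>Free abelian groups and abelianization\<close>

text \<open>Each subset B of X defines a homomorphism to Z/2, the parity of the coefficient sum over
  B. It is determined by the set of generators in T with odd value, and B is recovered from its
  values on the basis. So X has at most as many subsets as T.\<close>

lemma card_generators_free_Abelian_group:
  assumes X: "finite X" and T: "finite T" and gen: "generate (free_Abelian_group X) T = carrier (free_Abelian_group X)"
  shows "card X \<le> card T"
proof -
  let ?c = "\<lambda>B u. \<Sum>x\<in>B. poly_mapping.lookup u x"
  define F where "F B = {t \<in> T. odd (?c B t)}" for B
  have "inj_on F (Pow X)"
  proof (rule inj_onI)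
    fix B C assume B: "B \<in> Pow X" and C: "C \<in> Pow X" and eq: "F B = F C"
    have par: "odd (?c B u) \<longleftrightarrow> odd (?c C u)" if "u \<in> generate (free_Abelian_group X) T" for u
      using that
    proof induction
      case (incl h)
      then show ?case using eq by (auto simp: F_def)
    next
      case (inv h)
      moreover have "h \<in> carrier (free_Abelian_group X)" using inv gen generate.incl by metis
      then have "inv\<^bsub>free_Abelian_group X\<^esub> h = - h" by simp
      ultimately show ?case using eq by (auto simp: F_def sum_negf)
    qed (auto simp: lookup_add sum.distrib)
    have "x \<in> B \<longleftrightarrow> x \<in> C" if "x \<in> X" for x
    proof -
      have "finite B" "finite C" using B C X finite_subset by auto
      moreover have "frag_of x \<in> generate (free_Abelian_group X) T" using that gen by simp
      from par[OF this] have "odd (?c B (frag_of x)) \<longleftrightarrow> odd (?c C (frag_of x))" .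
      ultimately show ?thesis by (auto simp: when_def split: if_splits)
    qed
    then show "B = C" using B C by blast
  qed
  moreover have "F ` Pow X \<subseteq> Pow T" by (auto simp: F_def)
  ultimately have "card (Pow X) \<le> card (Pow T)"
    using T by (intro card_inj_on_le[of F]) auto
  then show ?thesis using X T by (simp add: card_Pow)
qed

lemma generate_frag_of:
  "generate (free_Abelian_group X) (frag_of ` X) = carrier (free_Abelian_group X)"
proof -
  let ?H = "free_Abelian_group X"
  interpret group ?H by simp
  have sub: "subgroup (generate ?H (frag_of ` X)) ?H" by (rule generate_is_subgroup) auto
  have "u \<in> generate ?H (frag_of ` X)" if "Poly_Mapping.keys u \<subseteq> X" for u
  proof (rule free_Abelian_group_induct[OF that])
    show "0 \<in> generate ?H (frag_of ` X)" using generate.one[of ?H] by simp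
  next
    fix x y
    assume xy: "Poly_Mapping.keys x \<subseteq> X" "Poly_Mapping.keys y \<subseteq> X"
      "x \<in> generate ?H (frag_of ` X)" "y \<in> generate ?H (frag_of ` X)"
    then have "x \<otimes>\<^bsub>?H\<^esub> inv\<^bsub>?H\<^esub> y \<in> generate ?H (frag_of ` X)"
      using sub by (blast intro: subgroup.m_closed subgroup.m_inv_closed)
    then show "x - y \<in> generate ?H (frag_of ` X)" using xy by simp
  next
    fix a assume "a \<in> X"
    then show "frag_of a \<in> generate ?H (frag_of ` X)" by (intro generate.incl) auto
  qed
  then have "carrier ?H \<subseteq> generate ?H (frag_of ` X)" by (intro subsetI) simp
  with subgroup.subset[OF sub] show ?thesis by (rule subset_antisym)
qed

text \<open>S is the image of the basis. A competing generating set is carried back to the free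
  group, where the parity bound applies.\<close>

lemma iso_free_Abelian_group_minimal_generating_set:
  assumes A: "group A" and iso: "A \<cong> free_Abelian_group X" and X: "finite X"
  shows "\<exists>S. minimal_generating_set A S \<and> card S = card X \<and> A \<cong> free_Abelian_group S"
proof -
  let ?H = "free_Abelian_group X"
  obtain g where g: "g \<in> iso A ?H" using iso by (auto simp: is_iso_def)
  have "?H \<cong> A" using group.iso_sym[OF A iso] .
  then obtain f where f: "f \<in> iso ?H A" by (auto simp: is_iso_def)
  interpret f: group_hom ?H A f using f A by (auto simp: group_hom_def group_hom_axioms_def iso_def)
  interpret g: group_hom A ?H g using g A by (auto simp: group_hom_def group_hom_axioms_def iso_def)
  define S where "S = f ` frag_of ` X"
  have "inj_on f (carrier ?H)" "f ` carrier ?H = carrier A"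
    using f by (auto simp: iso_def bij_betw_def)
  have sub: "frag_of ` X \<subseteq> carrier ?H" by auto
  have inj: "inj_on (f \<circ> frag_of) X"
  proof (rule inj_onI)
    fix x y assume "x \<in> X" "y \<in> X" "(f \<circ> frag_of) x = (f \<circ> frag_of) y"
    then have "frag_of x = frag_of y" using inj_onD[OF \<open>inj_on f (carrier ?H)\<close>] by simp
    then show "x = y" by (simp add: frag_of_eq)
  qed
  have S: "S = (f \<circ> frag_of) ` X" by (auto simp: S_def)
  have card: "card S = card X" unfolding S by (rule card_image[OF inj])
  have "X \<approx> S" unfolding S using inj eqpoll_sym inj_on_image_eqpoll_self by blast
  then have "?H \<cong> free_Abelian_group S" by (simp add: isomorphic_free_Abelian_groups)
  then have "A \<cong> free_Abelian_group S" using iso iso_trans by blast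
  moreover have "minimal_generating_set A S"
    unfolding minimal_generating_set_def
  proof (intro conjI allI impI)
    show "finite S" using X S by simp
    show "S \<subseteq> carrier A" unfolding S_def using \<open>f ` carrier ?H = carrier A\<close> sub by blast
    show "generate A S = carrier A"
      unfolding S_def f.generate_img[OF sub] generate_frag_of by (rule \<open>f ` carrier ?H = carrier A\<close>)
  next
    fix T assume T: "finite T \<and> T \<subseteq> carrier A \<and> generate A T = carrier A"
    have "generate ?H (g ` T) = g ` carrier A"
      using g.generate_img[of T] T by simp
    also have "\<dots> = carrier ?H" using g by (auto simp: iso_def bij_betw_def)
    finally have "card X \<le> card (g ` T)"
      using card_generators_free_Abelian_group[OF X] T by blast
    then show "card S \<le> card T"
      using card_image_le[of T g] T card by simp
  qed
  ultimately show ?thesis using card by blast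
qed

text \<open>A homomorphism to a commutative group kills all commutators, so the assumed inclusion is
  an equality and the first isomorphism theorem applies.\<close>

lemma abelianization_iso:
  assumes hom: "group_hom G H h" and H: "comm_group H"
    and onto: "h ` carrier G = carrier H"
    and ker: "kernel G H h \<subseteq> derived G (carrier G)"
  shows "abelianization G \<cong> H"
proof -
  interpret group_hom G H h by (rule hom)
  have "h ` derived G (carrier G) = derived H (h ` carrier G)"
    by (rule derived_img[symmetric]) simp
  also have "\<dots> = {\<one>\<^bsub>H\<^esub>}"
    using comm_group.derived_eq_singleton[OF H, of "carrier H"] onto by simp
  finally have "derived G (carrier G) \<subseteq> kernel G H h"
    using G.derived_in_carrier[of "carrier G"] unfolding kernel_def by blast
  then have "derived G (carrier G) = kernel G H h" using ker by blast
  then show ?thesis unfolding abelianization_def using FactGroup_iso[OF onto] by simp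
qed

section \<open>Loops in the flip graph\<close>

lemma walk_weight_append:
  "walk_weight (xs @ x # ys) Q = walk_weight (xs @ [x]) Q + walk_weight (x # ys) Q"
  by (induction xs rule: walk_weight.induct) (auto split: list.splits)

lemma walk_weight_rev: "walk_weight (rev l) Q = - walk_weight l Q"
proof (induction l rule: walk_weight.induct)
  case (1 x y l)
  have "walk_weight (rev (x # y # l)) Q = walk_weight (rev l @ y # [x]) Q" by simp
  also have "\<dots> = walk_weight (rev (y # l)) Q + flip_weight y x Q"
    using walk_weight_append[of "rev l" y "[x]" Q] by simp
  finally show ?case using 1 flip_weight_swap[of y x Q] by simp
qed auto

text \<open>Two adjacent rows of a grid form a ladder of squares, and the weights of the inner rungs
  telescope. For loops the end rungs join the base point to itself and have weight zero.\<close>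

lemma walk_weight_row:
  assumes "n \<ge> 2" "list_all2 (flip_near n) a b" "a \<noteq> []"
    "successively (flip_near n) a" "successively (flip_near n) b"
    "set a \<subseteq> triangulations n" "set b \<subseteq> triangulations n"
  shows "walk_weight a Q + flip_weight (last a) (last b) Q = flip_weight (hd a) (hd b) Q + walk_weight b Q"
  using assms(2-)
proof (induction a b rule: list_all2_induct)
  case (Cons x xs y ys)
  show ?case
  proof (cases xs)
    case Nil
    then show ?thesis using Cons by simp
  next
    case (Cons x' xs')
    then obtain y' ys' where ys: "ys = y' # ys'" using Cons.hyps by (cases ys) auto
    have "flip_weight x x' Q + flip_weight x' y' Q = flip_weight x y Q + flip_weight y y' Q"
      using Cons.prems Cons.hyps ys \<open>xs = x' # xs'\<close> by (intro flip_weight_square[OF assms(1)]) auto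
    moreover have "walk_weight xs Q + flip_weight (last xs) (last ys) Q = flip_weight x' y' Q + walk_weight ys Q"
      using Cons.IH Cons.prems ys \<open>xs = x' # xs'\<close> by auto
    ultimately show ?thesis using ys \<open>xs = x' # xs'\<close> by simp
  qed
qed simp

locale flip_loops =
  fixes n :: nat and \<sigma> :: "(nat \<times> nat) set"
  assumes n: "n \<ge> 2" and base: "\<sigma> \<in> triangulations n"
begin

abbreviation "loops \<equiv> q_loops (noncrossing_complex n) (n - 2) \<sigma>"
abbreviation "homotopic \<equiv> loop_equiv (noncrossing_complex n) (n - 2) \<sigma>"
abbreviation "loop_class l \<equiv> loop_rel (noncrossing_complex n) (n - 2) \<sigma> `` {l}"
abbreviation "G \<equiv> discrete_fundamental_group (noncrossing_complex n) (n - 2) \<sigma>"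

sublocale G: group G
  by (rule group_discrete_fundamental_group[OF base])

lemma loops_iff:
  "l \<in> loops \<longleftrightarrow> l \<noteq> [] \<and> hd l = \<sigma> \<and> last l = \<sigma> \<and> set l \<subseteq> triangulations n \<and> successively (flip_near n) l"
  by (simp add: q_loops_def)

lemma homotopic_weight: "homotopic a b \<Longrightarrow> walk_weight a Q = walk_weight b Q"
proof (induction rule: loop_equiv.induct)
  case (repeat_term xs x ys)
  then show ?case
    using walk_weight_append[of xs x ys Q] walk_weight_append[of xs x "x # ys" Q] by simp
next
  case (grid gs)
  then show ?case
  proof (induction gs rule: induct_list012)
    case (3 a b gs)
    have L: "a \<in> loops" "b \<in> loops" and ab: "list_all2 (flip_near n) a b" using 3 by auto
    have "walk_weight a Q = walk_weight b Q"
      using walk_weight_row[OF n ab, of Q] L unfolding loops_iff by simp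
    moreover have "walk_weight b Q = walk_weight (last (b # gs)) Q" using 3 by auto
    ultimately show ?case by simp
  qed auto
qed auto

lemma loop_class_eq: "homotopic a b \<Longrightarrow> loop_class a = loop_class b"
  using equiv_class_eq[OF equiv_loop_rel] by (simp add: loop_rel_def)

lemma loop_class_mult:
  assumes "a \<in> loops" "b \<in> loops"
  shows "loop_class a \<otimes>\<^bsub>G\<^esub> loop_class b = loop_class (a @ tl b)"
proof -
  have "loop_class (a' @ tl b') = loop_class (a @ tl b)" if "homotopic a a'" "homotopic b b'" for a' b'
    using concat_cong_left[OF that(1) assms(2)] concat_cong_right[OF that(2), of a'] that
      loop_equiv_loops loop_class_eq by metis
  then have "\<forall>a'\<in>loop_class a. \<forall>b'\<in>loop_class b. loop_class (a' @ tl b') = loop_class (a @ tl b)"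
    by (simp add: loop_rel_def)
  moreover have "a \<in> loop_class a" "b \<in> loop_class b"
    using assms loop_equiv.refl by (simp_all add: loop_rel_def)
  ultimately have "(\<Union>a'\<in>loop_class a. \<Union>b'\<in>loop_class b. loop_class (a' @ tl b')) = loop_class (a @ tl b)"
    by blast
  then show ?thesis
    by (simp add: discrete_fundamental_group_def)
qed

lemma carrier_G: "carrier G = {loop_class l |l. l \<in> loops}"
  by (auto simp: discrete_fundamental_group_def quotient_def)

lemma one_G: "\<one>\<^bsub>G\<^esub> = loop_class [\<sigma>]"
  by (simp add: discrete_fundamental_group_def)

section \<open>The weight homomorphism to the free abelian group\<close>

definition weight_frag :: "(nat \<times> nat) set list \<Rightarrow> (nat \<times> nat \<times> nat \<times> nat) \<Rightarrow>\<^sub>0 int" where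
  "weight_frag l = (\<Sum>Q\<in>rootless_quads n. frag_cmul (walk_weight l Q) (frag_of Q))"

definition weight_hom :: "(nat \<times> nat) set list set \<Rightarrow> (nat \<times> nat \<times> nat \<times> nat) \<Rightarrow>\<^sub>0 int" where
  "weight_hom C = weight_frag (SOME l. l \<in> C)"

lemma weight_hom_class:
  assumes "l \<in> loops"
  shows "weight_hom (loop_class l) = weight_frag l"
proof -
  have "l \<in> loop_class l" using assms loop_equiv.refl by (auto simp: loop_rel_def)
  then have "(SOME l'. l' \<in> loop_class l) \<in> loop_class l" by (rule someI)
  then have "homotopic l (SOME l'. l' \<in> loop_class l)" by (simp add: loop_rel_def)
  then show ?thesis by (simp add: weight_hom_def weight_frag_def homotopic_weight)
qed

lemma lookup_weight_frag:
  assumes "Q \<in> rootless_quads n"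
  shows "poly_mapping.lookup (weight_frag l) Q = walk_weight l Q"
proof -
  have "poly_mapping.lookup (weight_frag l) Q = (\<Sum>R\<in>rootless_quads n. if R = Q then walk_weight l R else 0)"
    unfolding weight_frag_def lookup_sum by (intro sum.cong) (auto simp: when_def)
  then show ?thesis using assms finite_rootless_quads by simp
qed

lemma weight_frag_closed: "weight_frag l \<in> carrier (free_Abelian_group (rootless_quads n))"
  unfolding weight_frag_def by (rule sum_closed_free_Abelian_group) (auto simp: keys_frag_of)

lemma weight_frag_eqI:
  assumes "\<And>Q. Q \<in> rootless_quads n \<Longrightarrow> walk_weight l Q = poly_mapping.lookup u Q" "Poly_Mapping.keys u \<subseteq> rootless_quads n"
  shows "weight_frag l = u"
proof (rule poly_mapping_eqI)
  fix Q
  show "poly_mapping.lookup (weight_frag l) Q = poly_mapping.lookup u Q"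
  proof (cases "Q \<in> rootless_quads n")
    case True
    then show ?thesis using assms by (simp add: lookup_weight_frag)
  next
    case False
    then have "Q \<notin> Poly_Mapping.keys u" "Q \<notin> Poly_Mapping.keys (weight_frag l)"
      using assms(2) weight_frag_closed[of l] by auto
    then show ?thesis by (simp add: in_keys_iff)
  qed
qed

lemma walk_weight_concat:
  assumes "a \<in> loops" "b \<in> loops"
  shows "walk_weight (a @ tl b) Q = walk_weight a Q + walk_weight b Q"
proof -
  obtain a' where a: "a = a' @ [\<sigma>]" using assms(1) unfolding loops_iff by (metis append_butlast_last_id)
  obtain b' where b: "b = \<sigma> # b'" using assms(2) unfolding loops_iff by (metis list.collapse)
  show ?thesis unfolding a b using walk_weight_append[of a' \<sigma> b' Q] by simp
qed

sublocale weight: group_hom G "free_Abelian_group (rootless_quads n)" weight_hom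
proof (intro group_hom.intro group_hom_axioms.intro homI G.is_group group_free_Abelian_group)
  fix C assume "C \<in> carrier G"
  then show "weight_hom C \<in> carrier (free_Abelian_group (rootless_quads n))"
    by (simp only: weight_hom_def weight_frag_closed)
next
  fix C D assume "C \<in> carrier G" "D \<in> carrier G"
  then obtain a b where ab: "C = loop_class a" "D = loop_class b" "a \<in> loops" "b \<in> loops"
    unfolding carrier_G by auto
  have "weight_frag (a @ tl b) = weight_frag a + weight_frag b"
    unfolding weight_frag_def using ab(3,4)
    by (simp add: walk_weight_concat frag_cmul_distrib sum.distrib)
  then show "weight_hom (C \<otimes>\<^bsub>G\<^esub> D) = weight_hom C \<otimes>\<^bsub>free_Abelian_group (rootless_quads n)\<^esub> weight_hom D"
    using ab(3,4) unfolding ab(1,2) by (simp add: loop_class_mult weight_hom_class concat_loops)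
qed

section \<open>Paths to the base point and elementary homotopies\<close>

definition is_path :: "(nat \<times> nat) set list \<Rightarrow> (nat \<times> nat) set \<Rightarrow> (nat \<times> nat) set \<Rightarrow> bool" where
  "is_path p x y \<longleftrightarrow> p \<noteq> [] \<and> hd p = x \<and> last p = y \<and> set p \<subseteq> triangulations n \<and> successively (flip_near n) p"

lemma loop_iff_path: "l \<in> loops \<longleftrightarrow> is_path l \<sigma> \<sigma>"
  by (simp add: loops_iff is_path_def)

lemma path_rev: "is_path p x y \<Longrightarrow> is_path (rev p) y x"
  by (auto simp: is_path_def hd_rev last_rev elim: successively_mono dest: q_near_sym)

lemma path_append: "is_path p x y \<Longrightarrow> is_path p' y' z \<Longrightarrow> flip_near n y y' \<Longrightarrow> is_path (p @ p') x z"
  by (auto simp: is_path_def successively_append_iff)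

lemma path_tri: "is_path p x y \<Longrightarrow> x \<in> triangulations n" "is_path p x y \<Longrightarrow> y \<in> triangulations n"
  by (auto simp: is_path_def)

lemma path_single: "x \<in> triangulations n \<Longrightarrow> is_path [x] x x"
  by (simp add: is_path_def)

text \<open>The flip graph is connected, with the fan as the common target of down flips at
  0.\<close>

lemma path_to_fan: "T \<in> triangulations n \<Longrightarrow> \<exists>p. is_path p T (fan n)"
proof (induction "\<Sum>(i, j)\<in>T. i + j" arbitrary: T rule: less_induct)
  case less
  show ?case
  proof (cases "\<exists>b c d. down_quad n T 0 b c d")
    case False
    then have "T = fan n" using zero_terminal_is_fan less.prems by blast
    then show ?thesis using path_single less.prems by blast
  next
    case True
    then obtain b c d where Q: "down_quad n T 0 b c d" by blast
    obtain p where "is_path p (down_flip 0 b c d T) (fan n)"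
      using less.hyps[OF down_flip_measure[OF less.prems Q] down_flip_triangulation[OF less.prems Q]] by blast
    from path_append[OF path_single[OF less.prems] this near_down_flip[OF n less.prems Q]]
    show ?thesis by blast
  qed
qed

lemma path_exists:
  assumes "x \<in> triangulations n"
  shows "\<exists>p. is_path p \<sigma> x"
proof -
  obtain p p' where p: "is_path p \<sigma> (fan n)" "is_path p' x (fan n)"
    using path_to_fan base assms by blast
  then show ?thesis
    using path_append[OF p(1) path_rev[OF p(2)] flip_near_refl[OF n path_tri(2)[OF p(1)]]] by blast
qed

text \<open>The constant path at the base point is prescribed so that the cocycle product along a
  loop gives the class of that very loop, with no path attached at its ends.\<close>

definition path :: "(nat \<times> nat) set \<Rightarrow> (nat \<times> nat) set list" where
  "path x = (if x = \<sigma> then [\<sigma>] else SOME p. is_path p \<sigma> x)"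

lemma is_path_path: "x \<in> triangulations n \<Longrightarrow> is_path (path x) \<sigma> x"
  using path_exists[of x] path_single[OF base] by (auto simp: path_def intro: someI_ex)

text \<open>The walk runs backwards along p, turns at its first vertex and returns to its last. Each
  backtrack at the turning point removes the front element of p.\<close>

lemma cancel_return:
  assumes "p \<noteq> []" "xs @ rev p @ tl p @ ys \<in> loops"
  shows "homotopic (xs @ rev p @ tl p @ ys) (xs @ [last p] @ ys)"
  using assms
proof (induction p rule: induct_list012)
  case (2 a)
  then show ?case using loop_equiv.refl by simp
next
  case (3 a b p)
  have "homotopic (xs @ rev (a # b # p) @ tl (a # b # p) @ ys) (xs @ rev (b # p) @ tl (b # p) @ ys)"
    using backtrack[of "xs @ rev p" b a "p @ ys"] 3(4) by simp
  moreover then have "xs @ rev (b # p) @ tl (b # p) @ ys \<in> loops" using loop_equiv_loops by blast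
  ultimately show ?case using 3(2) loop_equiv.trans by fastforce
qed simp

lemma repeat_iff: "xs @ [x, x] @ ys \<in> loops \<longleftrightarrow> xs @ [x] @ ys \<in> loops"
proof -
  have "hd (xs @ [x, x] @ ys) = hd (xs @ [x] @ ys)" by (cases xs) auto
  moreover have "last (xs @ [x, x] @ ys) = last (xs @ [x] @ ys)" by simp
  moreover have "flip_near n x x" if "x \<in> triangulations n" by (rule flip_near_refl[OF n that])
  ultimately show ?thesis
    by (auto simp: loops_iff successively_append_iff successively_Cons)
qed

lemma homotopic_repeat: "xs @ [x] @ ys \<in> loops \<Longrightarrow> homotopic (xs @ [x] @ ys) (xs @ [x, x] @ ys)"
  by (intro loop_equiv.repeat_term) (simp_all only: repeat_iff)

text \<open>A grid from x, y, z directly to x, t, z would need y near t. Repeating z in one loop and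
  x in the other shifts the columns to x over x, y over x, z over t, z over z, all of which are
  near.\<close>

lemma homotopic_square:
  assumes "xs @ [x, y, z] @ ys \<in> loops" "xs @ [x, t, z] @ ys \<in> loops"
  shows "homotopic (xs @ [x, y, z] @ ys) (xs @ [x, t, z] @ ys)"
proof -
  let ?a = "xs @ [x, y, z, z] @ ys" and ?b = "xs @ [x, x, t, z] @ ys"
  have a: "homotopic (xs @ [x, y, z] @ ys) ?a"
    using homotopic_repeat[of "xs @ [x, y]" z ys] assms(1) by simp
  have b: "homotopic (xs @ [x, t, z] @ ys) ?b"
    using homotopic_repeat[of xs x "[t, z] @ ys"] assms(2) by simp
  have L: "?a \<in> loops" "?b \<in> loops" using a b loop_equiv_loops by blast+
  have self: "flip_near n u u" if "u \<in> set ?a" for u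
    using L(1) that flip_near_refl[OF n] unfolding loops_iff by blast
  have "flip_near n x y" "flip_near n t z"
    using assms by (auto simp: loops_iff successively_append_iff)
  then have "list_all2 (flip_near n) ?a ?b"
    using self by (intro list_all2_appendI list_all2_self) (auto intro: q_near_sym)
  then have "homotopic ?a ?b"
    using loop_equiv.grid[of "[?a, ?b]"] L by simp
  then show ?thesis using a b loop_equiv.sym loop_equiv.trans by meson
qed

section \<open>The tautological cocycle with values in the abelianization\<close>

abbreviation "A \<equiv> abelianization G"

sublocale A: comm_group A
  unfolding abelianization_def by (rule G.derived_quot_is_comm_group)

definition homology_class :: "(nat \<times> nat) set list \<Rightarrow> (nat \<times> nat) set list set set" where
  "homology_class l = derived G (carrier G) #>\<^bsub>G\<^esub> loop_class l"

lemma homology_class_hom: "(\<lambda>C. derived G (carrier G) #>\<^bsub>G\<^esub> C) \<in> hom G A"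
  unfolding abelianization_def by (rule normal.r_coset_hom_Mod[OF G.derived_self_is_normal])

lemma homology_class_mult:
  assumes "a \<in> loops" "b \<in> loops"
  shows "homology_class a \<otimes>\<^bsub>A\<^esub> homology_class b = homology_class (a @ tl b)"
proof -
  have "loop_class a \<in> carrier G" "loop_class b \<in> carrier G" using assms carrier_G by auto
  from hom_mult[OF homology_class_hom this] show ?thesis
    unfolding homology_class_def loop_class_mult[OF assms] by simp
qed

lemma homology_class_closed: "l \<in> loops \<Longrightarrow> homology_class l \<in> carrier A"
  using hom_in_carrier[OF homology_class_hom, of "loop_class l"] carrier_G by (auto simp: homology_class_def)

lemma homology_class_eq: "homotopic a b \<Longrightarrow> homology_class a = homology_class b"
  by (simp add: homology_class_def loop_class_eq)

lemma homology_class_one: "homology_class [\<sigma>] = \<one>\<^bsub>A\<^esub>"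
  unfolding homology_class_def one_G[symmetric]
  using hom_one[OF homology_class_hom G.is_group A.is_group] by simp

definition cocycle :: "(nat \<times> nat) set \<Rightarrow> (nat \<times> nat) set \<Rightarrow> (nat \<times> nat) set list set set" where
  "cocycle x y = homology_class (path x @ rev (path y))"

lemma cocycle_loop:
  assumes "x \<in> triangulations n" "y \<in> triangulations n" "flip_near n x y"
  shows "path x @ rev (path y) \<in> loops"
  unfolding loop_iff_path
  by (rule path_append[OF is_path_path[OF assms(1)] path_rev[OF is_path_path[OF assms(2)]] assms(3)])

text \<open>The return along \<open>rev (path y)\<close> is followed by \<open>path y\<close> again;
  \<open>cancel_return\<close> reduces this detour to the single term y.\<close>

lemma cocycle_mult:
  assumes x: "x \<in> triangulations n" and y: "y \<in> triangulations n" and xy: "flip_near n x y"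
    and p: "is_path (path y @ p) \<sigma> \<sigma>"
  shows "cocycle x y \<otimes>\<^bsub>A\<^esub> homology_class (path y @ p) = homology_class (path x @ [y] @ p)"
proof -
  have py: "path y \<noteq> []" "last (path y) = y" using is_path_path[OF y] by (auto simp: is_path_def)
  have L: "path x @ rev (path y) \<in> loops" "path y @ p \<in> loops"
    using cocycle_loop[OF x y xy] p loop_iff_path by auto
  have eq: "(path x @ rev (path y)) @ tl (path y @ p) = path x @ rev (path y) @ tl (path y) @ p"
    using py by simp
  have "homotopic (path x @ rev (path y) @ tl (path y) @ p) (path x @ [last (path y)] @ p)"
    by (rule cancel_return[OF py(1)]) (use concat_loops[OF L] eq in simp)
  then show ?thesis
    unfolding cocycle_def homology_class_mult[OF L] eq by (simp add: homology_class_eq py(2))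
qed

sublocale cocycle: flip_cocycle A n cocycle
proof
  show "n \<ge> 2" by (rule n)
next
  fix x y assume "x \<in> triangulations n" "y \<in> triangulations n" "flip_near n x y"
  then show "cocycle x y \<in> carrier A"
    unfolding cocycle_def by (intro homology_class_closed cocycle_loop)
next
  fix x assume x: "x \<in> triangulations n"
  have L: "path x @ rev (path x) \<in> loops" by (rule cocycle_loop[OF x x flip_near_refl[OF n x]])
  obtain p where p: "path x = p @ [x]"
    using is_path_path[OF x] unfolding is_path_def by (metis append_butlast_last_id)
  \<comment> \<open>The loop for the pair x, x repeats x at its turning point. Without the
    repetition it is a palindrome, which \<open>path_back\<close> contracts.\<close>
  have "p @ [x] @ rev p \<in> loops"
    using L repeat_iff[of p x "rev p"] unfolding p by simp
  then have "homotopic (p @ [x] @ rev p) [\<sigma>]" "homotopic (p @ [x] @ rev p) (p @ [x, x] @ rev p)"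
    using path_back homotopic_repeat by blast+
  then have "homotopic (path x @ rev (path x)) [\<sigma>]"
    unfolding p using loop_equiv.sym loop_equiv.trans by fastforce
  then show "cocycle x x = \<one>\<^bsub>A\<^esub>"
    by (simp add: cocycle_def homology_class_eq homology_class_one)
next
  fix x y z t
  assume tri: "x \<in> triangulations n" "y \<in> triangulations n" "z \<in> triangulations n" "t \<in> triangulations n"
    and near: "flip_near n x y" "flip_near n y z" "flip_near n x t" "flip_near n t z"
  obtain p where p: "path x = p @ [x]"
    using is_path_path[OF tri(1)] unfolding is_path_def by (metis append_butlast_last_id)
  obtain q where q: "path z = q @ [z]"
    using is_path_path[OF tri(3)] unfolding is_path_def by (metis append_butlast_last_id)
  \<comment> \<open>Both sides of the square axiom have this shape; the resulting loops differ only
    in the middle term u, so \<open>homotopic_square\<close> applies.\<close>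
  have step: "cocycle x u \<otimes>\<^bsub>A\<^esub> cocycle u z = homology_class (p @ [x, u, z] @ rev q)"
    "p @ [x, u, z] @ rev q \<in> loops"
    if u: "u \<in> triangulations n" "flip_near n x u" "flip_near n u z" for u
  proof -
    have "is_path (path u @ rev (path z)) \<sigma> \<sigma>" using cocycle_loop[OF u(1) tri(3) u(3)] loop_iff_path by blast
    from cocycle_mult[OF tri(1) u(1,2) this]
    show "cocycle x u \<otimes>\<^bsub>A\<^esub> cocycle u z = homology_class (p @ [x, u, z] @ rev q)"
      unfolding cocycle_def p q by simp
    have "is_path ((path x @ [u]) @ rev (path z)) \<sigma> \<sigma>"
      using path_append[OF path_append[OF is_path_path[OF tri(1)] path_single[OF u(1)] u(2)]
          path_rev[OF is_path_path[OF tri(3)]] u(3)] .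
    then show "p @ [x, u, z] @ rev q \<in> loops" unfolding loop_iff_path p q by simp
  qed
  show "cocycle x y \<otimes>\<^bsub>A\<^esub> cocycle y z = cocycle x t \<otimes>\<^bsub>A\<^esub> cocycle t z"
    using step[OF tri(2) near(1,2)] step[OF tri(4) near(3,4)] homology_class_eq homotopic_square by metis
qed

text \<open>Consecutive factors cancel their connecting paths to the base point. The end vertex z is
  dropped from the walk by \<open>butlast\<close> because \<open>rev (path z)\<close> begins with
  it. Membership in \<open>loops\<close> is carried along for the induction.\<close>

lemma walk_product_homology:
  assumes "is_path (x # y # l) x z"
  shows "cocycle.walk_product (x # y # l) = homology_class (path x @ butlast (y # l) @ rev (path z))
    \<and> path x @ butlast (y # l) @ rev (path z) \<in> loops"
  using assms
proof (induction l arbitrary: x y)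
  case Nil
  then have "x \<in> triangulations n" "y \<in> triangulations n" "flip_near n x y" "z = y"
    by (auto simp: is_path_def)
  then show ?case using cocycle_loop cocycle.cocycle_closed by (simp add: cocycle_def[symmetric])
next
  case (Cons w l)
  have xy: "x \<in> triangulations n" "y \<in> triangulations n" "flip_near n x y" "is_path (y # w # l) y z"
    using Cons.prems by (auto simp: is_path_def)
  have IH: "cocycle.walk_product (y # w # l) = homology_class (path y @ butlast (w # l) @ rev (path z))"
    "path y @ butlast (w # l) @ rev (path z) \<in> loops"
    using Cons.IH[OF xy(4)] by auto
  have "path x @ butlast (y # w # l) @ rev (path z) \<in> loops"
  proof -
    have py: "path y \<noteq> []" "last (path y) = y" using is_path_path[OF xy(2)] by (auto simp: is_path_def)
    have "butlast (w # l) @ rev (path z) \<noteq> []" "last (butlast (w # l) @ rev (path z)) = \<sigma>"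
      "set (butlast (w # l) @ rev (path z)) \<subseteq> triangulations n"
      "successively (flip_near n) (butlast (w # l) @ rev (path z))"
      "flip_near n y (hd (butlast (w # l) @ rev (path z)))"
      using IH(2) py is_path_path[OF path_tri(2)[OF xy(4)]]
      by (auto simp: loops_iff successively_append_iff is_path_def last_rev hd_append last_append split: if_splits)
    then have "is_path (butlast (w # l) @ rev (path z)) (hd (butlast (w # l) @ rev (path z))) \<sigma>"
      and nr: "flip_near n y (hd (butlast (w # l) @ rev (path z)))"
      by (auto simp: is_path_def)
    from path_append[OF path_append[OF is_path_path[OF xy(1)] path_single[OF xy(2)] xy(3)] this]
    show ?thesis by (simp add: loop_iff_path)
  qed
  moreover have "cocycle.walk_product (x # y # w # l) = homology_class (path x @ butlast (y # w # l) @ rev (path z))"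
    using cocycle_mult[OF xy(1-3), of "butlast (w # l) @ rev (path z)"] IH loop_iff_path by simp
  ultimately show ?case by blast
qed

text \<open>For the tautological cocycle the product along a loop is its homology class, and a loop
  of weight zero has trivial product for every cocycle.\<close>

lemma kernel_weight_hom: "kernel G (free_Abelian_group (rootless_quads n)) weight_hom \<subseteq> derived G (carrier G)"
proof
  fix C assume "C \<in> kernel G (free_Abelian_group (rootless_quads n)) weight_hom"
  then obtain l where C: "C = loop_class l" and l: "l \<in> loops" and "weight_frag l = 0"
    by (auto simp: kernel_def carrier_G weight_hom_class)
  then have zero: "walk_weight l Q = 0" if "Q \<in> rootless_quads n" for Q
    using lookup_weight_frag[OF that, of l] by simp
  have "homology_class l = \<one>\<^bsub>A\<^esub>"
  proof (cases l rule: remdups_adj.cases)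
    case (3 x y l')
    have "cocycle.walk_product l = \<one>\<^bsub>A\<^esub>"
      using l zero by (intro cocycle.closed_walk_product) (auto simp: loops_iff)
    moreover have "x = \<sigma>" "last (y # l') = \<sigma>" using l 3 by (auto simp: loops_iff)
    moreover then have "\<sigma> # butlast (y # l') @ [\<sigma>] = l" using 3 append_butlast_last_id[of "y # l'"] by simp
    moreover have "path \<sigma> = [\<sigma>]" by (simp add: path_def)
    ultimately show ?thesis
      using walk_product_homology[of x y l' \<sigma>] l 3 by (simp add: loop_iff_path)
  qed (use l in \<open>auto simp: loops_iff homology_class_one\<close>)
  then have "derived G (carrier G) #>\<^bsub>G\<^esub> C = derived G (carrier G)"
    by (simp add: homology_class_def C abelianization_def)
  moreover have "C \<in> carrier G" using C l carrier_G by blast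
  ultimately show "C \<in> derived G (carrier G)"
    using G.rcos_self[OF _ G.derived_is_subgroup[of "carrier G"]] by blast
qed

text \<open>The pentagon is reached from the base point along \<open>path T\<close> and left by the
  reverse path, whose weights cancel. Four of its five flips are at 0 and have no weight on
  quadrilaterals avoiding 0.\<close>

lemma pentagon_loop:
  assumes "Q \<in> rootless_quads n"
  obtains l where "l \<in> loops" "\<And>R. R \<in> rootless_quads n \<Longrightarrow> walk_weight l R = of_bool (R = Q)"
proof -
  obtain a b c d where Q: "Q = (a, b, c, d)" and abcd: "0 < a" "a < b" "b < c" "c < d" "d \<le> n + 2"
    using assms by (auto simp: rootless_quads_def)
  obtain T where T: "T \<in> triangulations n" and D: "down_quad n T a b c d"
    and e: "edge n T 0 a" "edge n T 0 d"
    using quad_exists[OF abcd] .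
  note root = abcd(1) e
  note tri = down_flip_triangulation and near = near_down_flip[OF n]
  note Z1 = pentagon_first[OF T D root] and Z2 = pentagon_second[OF T D root]
    and Y1 = pentagon_first'[OF T D root] and Y2 = pentagon_second'[OF T D root]
  define T1 where "T1 = down_flip 0 a b d T"
  define T2 where "T2 = down_flip 0 b c d T1"
  define U where "U = down_flip a b c d T"
  define U1 where "U1 = down_flip 0 a c d U"
  have U2: "T2 = down_flip 0 a b c U1"
    unfolding T2_def T1_def U1_def U_def using pentagon_closes[OF T D root] by simp
  note Z2 = Z2[folded T1_def] and Y1 = Y1[folded U_def]
  note Y2 = Y2[folded U_def, folded U1_def]
  have T1: "T1 \<in> triangulations n" and U: "U \<in> triangulations n"
    unfolding T1_def U_def using tri[OF T Z1] tri[OF T D] by auto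
  have T2: "T2 \<in> triangulations n" and U1: "U1 \<in> triangulations n"
    unfolding T2_def U1_def using tri[OF T1 Z2] tri[OF U Y1] by auto
  have nr: "flip_near n T U" "flip_near n U U1" "flip_near n U1 T2" "flip_near n T T1" "flip_near n T1 T2"
    using near[OF T D] near[OF U Y1] near[OF U1 Y2] near[OF T Z1] near[OF T1 Z2]
    by (simp_all add: U_def[symmetric] U1_def[symmetric] U2[symmetric] T1_def[symmetric] T2_def[symmetric])
  let ?c = "[T, U, U1, T2, T1, T]"
  define p where "p = butlast (path T)"
  have p: "path T = p @ [T]"
    using is_path_path[OF T] unfolding is_path_def p_def by (metis append_butlast_last_id)
  have "is_path [U, U1, T2, T1] U T1"
    using nr T U U1 T1 T2 by (auto simp: is_path_def q_near_sym)
  from path_append[OF path_append[OF is_path_path[OF T] this nr(1)] path_rev[OF is_path_path[OF T]]]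
  have loop: "path T @ [U, U1, T2, T1] @ rev (path T) \<in> loops"
    using q_near_sym[OF nr(4)] by (simp add: loop_iff_path)
  have "walk_weight (path T @ [U, U1, T2, T1] @ rev (path T)) R = of_bool (R = Q)"
    if R: "R \<in> rootless_quads n" for R
  proof -
    have w: "flip_weight T U R = of_bool (R = Q)" "flip_weight U U1 R = 0" "flip_weight U1 T2 R = 0"
      "flip_weight T T1 R = 0" "flip_weight T1 T2 R = 0"
      using flip_weight_down_flip[OF T D R] flip_weight_down_flip[OF U Y1 R] flip_weight_down_flip[OF U1 Y2 R]
        flip_weight_down_flip[OF T Z1 R] flip_weight_down_flip[OF T1 Z2 R] R Q
      by (auto simp: U_def[symmetric] U1_def[symmetric] U2[symmetric] T1_def[symmetric] T2_def[symmetric]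
          rootless_quads_def)
    have "walk_weight (path T @ [U, U1, T2, T1] @ rev (path T)) R =
      walk_weight (p @ T # [U, U1, T2, T1] @ T # rev p) R" by (simp add: p)
    also have "\<dots> = walk_weight (p @ [T]) R + walk_weight ((T # [U, U1, T2, T1]) @ T # rev p) R"
      using walk_weight_append[of p T "[U, U1, T2, T1] @ T # rev p" R] by simp
    also have "walk_weight ((T # [U, U1, T2, T1]) @ T # rev p) R = walk_weight ?c R + walk_weight (rev (p @ [T])) R"
      using walk_weight_append[of "T # [U, U1, T2, T1]" T "rev p" R] by simp
    also have "walk_weight ?c R = of_bool (R = Q)"
      using w flip_weight_swap[of T2 T1 R] flip_weight_swap[of T1 T R] by simp
    finally show ?thesis unfolding walk_weight_rev by simp
  qed
  then show ?thesis using that[OF loop] by blast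
qed

lemma weight_hom_onto: "weight_hom ` carrier G = carrier (free_Abelian_group (rootless_quads n))"
proof
  let ?H = "free_Abelian_group (rootless_quads n)"
  have sub: "subgroup (weight_hom ` carrier G) ?H"
    by (rule weight.img_is_subgroup)
  have "frag_of ` rootless_quads n \<subseteq> weight_hom ` carrier G"
  proof
    fix u assume "u \<in> frag_of ` rootless_quads n"
    then obtain Q where Q: "Q \<in> rootless_quads n" "u = frag_of Q" by blast
    obtain l where l: "l \<in> loops" "\<And>R. R \<in> rootless_quads n \<Longrightarrow> walk_weight l R = of_bool (R = Q)"
      using pentagon_loop[OF Q(1)] by blast
    have "weight_frag l = u"
    proof (rule weight_frag_eqI)
      show "walk_weight l R = poly_mapping.lookup u R" if "R \<in> rootless_quads n" for R
        using l(2)[OF that] Q(2) by simp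
    qed (use Q in simp)
    then have "u = weight_hom (loop_class l)" using weight_hom_class[OF l(1)] by simp
    moreover have "loop_class l \<in> carrier G" using l(1) carrier_G by auto
    ultimately show "u \<in> weight_hom ` carrier G" by (rule image_eqI)
  qed
  then have "generate ?H (frag_of ` rootless_quads n) \<subseteq> weight_hom ` carrier G"
    by (rule weight.H.generate_subgroup_incl[OF _ sub])
  then show "carrier ?H \<subseteq> weight_hom ` carrier G" by (simp only: generate_frag_of)
qed (use weight.hom_closed in blast)

lemma abelianization_free: "A \<cong> free_Abelian_group (rootless_quads n)"
  by (rule abelianization_iso[OF weight.group_hom_axioms abelian_free_Abelian_group weight_hom_onto kernel_weight_hom])

end

theorem theorem1p2:
  fixes n :: nat and \<sigma>\<^sub>0 :: "(nat \<times> nat) set"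
  assumes "n \<ge> 2" and "\<sigma>\<^sub>0 \<in> maximal_simplices (noncrossing_complex n)"
  shows "\<exists>S. minimal_generating_set
               (abelianization (discrete_fundamental_group (noncrossing_complex n) (n - 2) \<sigma>\<^sub>0)) S \<and>
             card S = (n + 2) choose 4 \<and>
             abelianization (discrete_fundamental_group (noncrossing_complex n) (n - 2) \<sigma>\<^sub>0)
               \<cong> free_Abelian_group S"
proof -
  interpret flip_loops n \<sigma>\<^sub>0 using assms by unfold_locales
  show ?thesis
    using iso_free_Abelian_group_minimal_generating_set[OF A.is_group abelianization_free finite_rootless_quads]
    unfolding card_rootless_quads .
qed

end
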